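(* Let $a_j,b_j\in\mathbb{R}$, $j=1,\dots,r$, $a=\sum_{j=1}^ra_j$, and consider the splitting integrator $$\widetilde\phi_h=\phi^{(P)}_{b_rh}\circ\phi^{(U)}_{a_rh}\circ\cdots\circ\phi^{(P)}_{b_1h}\circ\phi^{(U)}_{a_1h}$$ for the system $\frac{d}{dt}(y,\theta)=(0,\omega)+f(y,\theta)$, where $\phi^{(U)}_t$ and $\phi^{(P)}_t$ are the exact $t$-flows of $\frac{d}{dt}(y,\theta)=(0,\omega)$ and of $\frac{d}{dt}(y,\theta)=f(y,\theta)$; let $\phi_t$ be the exact flow of the full system. Assume that: 1. The function $f(x)=f(y,\theta)$ is defined in a set $\Omega=B_R(y_0)\times\mathbb{T}^d$, where $B_R(y_0)$ is the ball $\{y:|y-y_0|<R\}\subset\mathbb{R}^{D-d}$. 2. There exists a finite set of indices $\mathcal{I}\subset\mathbb{Z}^d$ such that for $\mathbf{k}\notin\mathcal{I}$ the Fourier coefficient $\hat f_{\mathbf{k}}$ vanishes. 3. There exists an integer $N\ge2$ such that the Fourier coefficients $\hat f_{\mathbf{k}}$ and their partial derivatives of order $\le N-1$ are continuous and bounded in $B_R(y_0)$. Then there exist positive constants $h_0$, $C$, both independent of $\omega$, such that: 1. For $|h|<h_0$ and arbitrary $\theta_0$, the true solution $\phi_h(x_0)$, $x_0=(y_0,\theta_0)$, and the numerical solution $\widetilde\phi_h(x_0)$ are well defined and lie in $\Omega$. 2. The local error at $x_0$ satisfies $$\widetilde\phi_h(x_0)-\phi_h(x_0)=\begin{bmatrix}0\\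 h(a-1)\omega\end{bmatrix}+\sum_{n=1}^{N-1}h^n\sum_{\mathbf{k}_1,\dots,\mathbf{k}_n\in\mathcal{I}}\big(\widetilde A_{\mathbf{k}_1\cdots\mathbf{k}_n}(h)-A_{\mathbf{k}_1\cdots\mathbf{k}_n}(h)\big)f_{\mathbf{k}_1\cdots\mathbf{k}_n}(x_0)+\mathcal{R}_h(x_0),$$ where $|\mathcal{R}_h(x_0)|\le C|h|^N$.
   Context: **Setting.** Let $0<d\le D$ be integers and $x=(y,\theta)$ with $y\in\mathbb{R}^{D-d}$ and $\theta$ a vector of $d$ angles; $\omega\in\mathbb{R}^d$ has components $\omega_j>0$. The perturbation $f$ is $\mathbb{R}^D$-valued and $2\pi$-periodic in each component of $\theta$, with Fourier expansion $f(y,\theta)=\sum_{\mathbf{k}\in\mathbb{Z}^d}f_{\mathbf{k}}(y,\theta)$, $f_{\mathbf{k}}(y,\theta)=\exp(i\mathbf{k}\cdot\theta)\hat f_{\mathbf{k}}(y)$, where $\hat f_{\mathbf{k}}$ is $\mathbb{C}^D$-valued and $\hat f_{-\mathbf{k}}$ is the complex conjugate of $\hat f_{\mathbf{k}}$. $\mathbb{T}^d$ is the $d$-torus of angles modulo $2\pi$; in differences of solutions the angles are regarded as real numbers evolving continuously from $\theta_0$ (i.e. lifted to $\mathbb{R}^d$). **Word-basis functions.** For one letter, $f_{\mathbf{k}}(x)=f_{\mathbf{k}}(y,\theta)=\exp(i\mathbf{k}\cdot\theta)\hat f_{\mathbf{k}}(y)$, and for $n>1$, $f_{\mathbf{k}_1\cdots\mathbf{k}_n}(x)=\big(\partial_xf_{\mathbf{k}_2\cdots\mathbf{k}_n}(x)\big)f_{\mathbf{k}_1}(x)$,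 where $\partial_x$ is the Jacobian with respect to $x=(y,\theta)$. **Coefficients.** $$A_{\mathbf{k}_1\cdots\mathbf{k}_n}(h)=\int\cdots\int_{0\le t_1\le\cdots\le t_n\le1}\exp\big(i(t_1\mathbf{k}_1+\cdots+t_n\mathbf{k}_n)\cdot\omega h\big)\,dt_1\cdots dt_n,$$ $$\widetilde A_{\mathbf{k}_1\cdots\mathbf{k}_n}(h)=\sum_{1\le j_1\le\cdots\le j_n\le r}\frac{b_{j_1}\cdots b_{j_n}}{\sigma_{j_1\cdots j_n}}\exp\big(i(c_{j_1}\mathbf{k}_1+\cdots+c_{j_n}\mathbf{k}_n)\cdot\omega h\big),$$ where $c_j=a_1+\cdots+a_j$, $\sigma_{j_1\cdots j_n}=n!$ if $j_1=\cdots=j_n$, and $\sigma_{j_1\cdots j_n}=\ell!\,\sigma_{j_{\ell+1}\cdots j_n}$ if $\ell<n$ and $j_1=\cdots=j_\ell<j_{\ell+1}\le\cdots\le j_n$. *)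

theory Defs
  imports "HOL-Analysis.Analysis"
begin

text \<open>
  Phase space.  The state \<open>x = (y, \<theta>)\<close> is a vector in \<open>real ^ 'n\<close> with \<open>D = CARD('n)\<close>.  An injection
  \<open>ang :: 'd \<Rightarrow> 'n\<close> says which coordinates are the \<open>d = CARD('d)\<close> angles (lifted to the reals); the
  other \<open>D - d\<close> coordinates form \<open>y\<close>.  Separate types for \<open>y\<close> and \<open>\<theta>\<close> would exclude \<open>D = d\<close>, since
  index types are nonempty.  A value of \<open>y\<close> is represented by the vector of \<open>real ^ 'n\<close> whose angle
  coordinates are 0, so the Euclidean norm and the coordinate axes are those of \<open>\<real>\<^sup>D\<^sup>-\<^sup>d\<close>.
\<close>

definition yspace :: "('d \<Rightarrow> 'n::finite) \<Rightarrow> (real ^ 'n) set" where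
  "yspace ang = {y. \<forall>j. y $ ang j = 0}"

definition ypart :: "('d \<Rightarrow> 'n::finite) \<Rightarrow> real ^ 'n \<Rightarrow> real ^ 'n" where
  "ypart ang x = (\<chi> i. if i \<in> range ang then 0 else x $ i)"

definition angles :: "('d::finite \<Rightarrow> 'n::finite) \<Rightarrow> real ^ 'n \<Rightarrow> real ^ 'd" where
  "angles ang x = (\<chi> j. x $ ang j)"

definition state :: "('d::finite \<Rightarrow> 'n::finite) \<Rightarrow> real ^ 'n \<Rightarrow> real ^ 'd \<Rightarrow> real ^ 'n" where
  "state ang y \<theta> = (\<chi> i. if i \<in> range ang then \<theta> $ (inv ang i) else y $ i)"

definition yball :: "('d \<Rightarrow> 'n::finite) \<Rightarrow> real ^ 'n \<Rightarrow> real \<Rightarrow> (real ^ 'n) set" where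
  "yball ang y0 R = {y \<in> yspace ang. norm (y - y0) < R}"

definition phase_domain :: "('d \<Rightarrow> 'n::finite) \<Rightarrow> real ^ 'n \<Rightarrow> real \<Rightarrow> (real ^ 'n) set" where
  "phase_domain ang y0 R = {x. ypart ang x \<in> yball ang y0 R}"

definition cvec :: "real ^ 'n \<Rightarrow> complex ^ 'n" where
  "cvec v = (\<chi> i. complex_of_real (v $ i))"

definition kdot :: "int ^ 'd \<Rightarrow> real ^ 'd \<Rightarrow> real" where
  "kdot k v = (\<Sum>j\<in>UNIV. of_int (k $ j) * v $ j)"


text \<open>
  \<open>bounded_Ck S B m g\<close>: all partial derivatives of \<open>g\<close> of order at most \<open>m\<close> in the coordinates in \<open>S\<close>
  exist on \<open>B\<close> and are continuous and bounded there.
\<close>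

definition partial :: "'n \<Rightarrow> (real ^ 'n \<Rightarrow> 'a::real_normed_vector) \<Rightarrow> real ^ 'n::finite \<Rightarrow> 'a" where
  "partial i g y = vector_derivative (\<lambda>t. g (y + t *\<^sub>R axis i 1)) (at 0)"

primrec bounded_Ck ::
  "'n set \<Rightarrow> (real ^ 'n) set \<Rightarrow> nat \<Rightarrow> (real ^ 'n::finite \<Rightarrow> 'a::real_normed_vector) \<Rightarrow> bool" where
  "bounded_Ck S B 0 g \<longleftrightarrow> continuous_on B g \<and> bounded (g ` B)"
| "bounded_Ck S B (Suc m) g \<longleftrightarrow> continuous_on B g \<and> bounded (g ` B) \<and>
     (\<forall>i\<in>S. (\<forall>y\<in>B. (\<lambda>t. g (y + t *\<^sub>R axis i 1)) differentiable (at 0)) \<and>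
            bounded_Ck S B m (partial i g))"


definition mode ::
  "('d::finite \<Rightarrow> 'n::finite) \<Rightarrow> (int ^ 'd \<Rightarrow> real ^ 'n \<Rightarrow> complex ^ 'n) \<Rightarrow> int ^ 'd \<Rightarrow> real ^ 'n \<Rightarrow> complex ^ 'n"
where
  "mode ang fhat k x = exp (\<i> * complex_of_real (kdot k (angles ang x))) *s fhat k (ypart ang x)"

text \<open>
  The Jacobian of a complex-valued map of a real variable has complex entries, and is applied to
  complex vectors.
\<close>

definition cjacobian :: "(real ^ 'n \<Rightarrow> complex ^ 'm) \<Rightarrow> real ^ 'n::finite \<Rightarrow> complex ^ 'n ^ 'm::finite" where
  "cjacobian g x = (\<chi> i j. frechet_derivative g (at x) (axis j 1) $ i)"

text \<open>A word \<open>k\<^sub>1 \<dots> k\<^sub>n\<close> is a list; no equation is given for the empty word.\<close>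

fun word_basis ::
  "('d::finite \<Rightarrow> 'n::finite) \<Rightarrow> (int ^ 'd \<Rightarrow> real ^ 'n \<Rightarrow> complex ^ 'n) \<Rightarrow> (int ^ 'd) list \<Rightarrow>
   real ^ 'n \<Rightarrow> complex ^ 'n"
where
  "word_basis ang fhat [k] = mode ang fhat k"
| "word_basis ang fhat (k # l # w) =
     (\<lambda>x. cjacobian (word_basis ang fhat (l # w)) x *v mode ang fhat k x)"


definition ordered_simplex :: "nat \<Rightarrow> (nat \<Rightarrow> real) set" where
  "ordered_simplex n = {t. (\<forall>i<n. 0 \<le> t i \<and> t i \<le> 1) \<and> (\<forall>i j. i \<le> j \<and> j < n \<longrightarrow> t i \<le> t j)}"

definition exact_coeff :: "real ^ 'd \<Rightarrow> (int ^ 'd) list \<Rightarrow> real \<Rightarrow> complex" where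
  "exact_coeff \<omega> w h =
     (LINT t:ordered_simplex (length w)|(Pi\<^sub>M {..<length w} (\<lambda>_. lborel)).
        exp (\<i> * complex_of_real ((\<Sum>i<length w. t i * kdot (w ! i) \<omega>) * h)))"

text \<open>
  The product of \<open>l!\<close> over the maximal constant blocks of a list, \<open>l\<close> being the length of the block;
  the value 1 on the empty list makes the case of a single block part of the recursion.
\<close>

function sigma :: "nat list \<Rightarrow> nat" where
  "sigma [] = 1"
| "sigma (j # js) = fact (length (takeWhile ((=) j) (j # js))) * sigma (dropWhile ((=) j) (j # js))"
  by pat_completeness auto
termination
  by (relation "Wellfounded.measure length") (auto simp: le_imp_less_Suc length_dropWhile_le)

definition split_coeff ::
  "nat \<Rightarrow> (nat \<Rightarrow> real) \<Rightarrow> (nat \<Rightarrow> real) \<Rightarrow> real ^ 'd \<Rightarrow> (int ^ 'd) list \<Rightarrow> real \<Rightarrow> complex"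
where
  "split_coeff r a b \<omega> w h =
     (\<Sum>js \<in> {js. length js = length w \<and> sorted js \<and> set js \<subseteq> {1..r}}.
        complex_of_real (prod_list (map b js) / real (sigma js)) *
        exp (\<i> * complex_of_real ((\<Sum>i<length w. (\<Sum>l=1..js ! i. a l) * kdot (w ! i) \<omega>) * h)))"


definition solves_ivp ::
  "('a::real_normed_vector \<Rightarrow> 'a) \<Rightarrow> 'a set \<Rightarrow> 'a \<Rightarrow> real \<Rightarrow> (real \<Rightarrow> 'a) \<Rightarrow> bool"
where
  "solves_ivp F S x0 t X \<longleftrightarrow> X 0 = x0 \<and>
     (\<forall>s \<in> closed_segment 0 t. X s \<in> S \<and>
        (X has_vector_derivative F (X s)) (at s within closed_segment 0 t))"

text \<open>
  The \<open>t\<close>-flow, for \<open>t\<close> of either sign, of \<open>x' = F x\<close> in \<open>S\<close>, as a partial map: it is defined at \<open>x0\<close>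
  iff the initial value problem has a unique solution in \<open>S\<close> on the interval between 0 and \<open>t\<close>.
\<close>

definition flow ::
  "('a::real_normed_vector \<Rightarrow> 'a) \<Rightarrow> 'a set \<Rightarrow> real \<Rightarrow> 'a \<Rightarrow> 'a option"
where
  "flow F S t x0 =
     (if \<exists>X. solves_ivp F S x0 t X \<and>
            (\<forall>Y. solves_ivp F S x0 t Y \<longrightarrow> (\<forall>s \<in> closed_segment 0 t. Y s = X s))
      then Some ((SOME X. solves_ivp F S x0 t X) t)
      else None)"

text \<open>
  The first \<open>m\<close> stages of the splitting integrator with step \<open>h\<close>, each stage being the \<open>a\<^sub>j h\<close>-flow
  of \<open>U\<close> followed by the \<open>b\<^sub>j h\<close>-flow of \<open>P\<close>; the result is \<open>None\<close> if some flow involved is undefined.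
\<close>

primrec splitting ::
  "('a::real_normed_vector \<Rightarrow> 'a) \<Rightarrow> ('a \<Rightarrow> 'a) \<Rightarrow> 'a set \<Rightarrow> (nat \<Rightarrow> real) \<Rightarrow> (nat \<Rightarrow> real) \<Rightarrow> real \<Rightarrow>
   nat \<Rightarrow> 'a \<Rightarrow> 'a option"
where
  "splitting U P S a b h 0 x = Some x"
| "splitting U P S a b h (Suc m) x =
     Option.bind (Option.bind (splitting U P S a b h m x) (flow U S (a (Suc m) * h)))
       (flow P S (b (Suc m) * h))"

end

theory Submission
  imports Defs
begin

text \<open>
  Both solutions are turned into solutions of the same kind of non-autonomous problem.  Subtracting
  the accumulated drift of the angles from a solution leaves a curve \<open>z\<close> with
  \<open>z' = \<Sum>k\<in>I. \<alpha>\<^sub>k f\<^sub>k(z)\<close>, where \<open>\<alpha>\<^sub>k\<close> is a scalar function of time that contains the whole dependence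
  on \<open>\<omega>\<close> and satisfies \<open>|\<alpha>\<^sub>k| \<le> const |h|\<close>: a shift of the angles by \<open>\<theta>\<close> multiplies \<open>f\<^sub>k\<close> by
  \<open>exp(i k\<cdot>\<theta>)\<close>, a number of modulus one.  This is why all constants are independent of \<open>\<omega>\<close>.

  Along such a curve \<open>d/dt f\<^sub>w(z) = \<Sum>k\<in>I. \<alpha>\<^sub>k f\<^bsub>kw\<^esub>(z)\<close>, by the definition of the word-basis functions.
  Iterating this \<open>N\<close> times expands \<open>z\<close> in the functions \<open>f\<^sub>w(x\<^sub>0)\<close> with \<open>|w| < N\<close>, the coefficients
  being the iterated integrals of the \<open>\<alpha>\<^sub>k\<close>, and leaves a remainder bounded by
  \<open>sup |f\<^sub>w| (const |h|)\<^sup>N\<close> over words of length \<open>N\<close>.  Lemma \<open>word_expansion\<close> proves this by induction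
  with a mean value estimate, so that the remainder is never written as an integral.

  For the exact flow on the time interval scaled to \<open>[0,1]\<close> one has \<open>\<alpha>\<^sub>k(s) = h exp(i s h k\<cdot>\<omega>)\<close>, and
  the iterated integrals are \<open>h\<^sup>n A\<close> by Fubini's theorem (\<open>exact_coeff_eq_iterated\<close>).  For one stage
  of the splitting integrator \<open>\<alpha>\<^sub>k\<close> is constant in time and the iterated integrals are elementary.
  Expansions of successive stages compose by cutting words in two (\<open>word_expansion_compose\<close>), and the
  coefficients of the integrator satisfy the same recursion in the number of stages, because a
  nondecreasing index sequence in \<open>{1..m+1}\<close> is one in \<open>{1..m}\<close> followed by a block of indices
  \<open>m+1\<close> (\<open>split_coeff_Suc\<close>).

  Two further points need care.  The remainder has to be a real vector: the explicit part of the
  expansion is invariant under complex conjugation, since conjugation exchanges the terms of the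
  words \<open>w\<close> and \<open>-w\<close> (\<open>conj_vec_word_sum\<close>).  Well-definedness of the flows for a time independent of
  \<open>\<omega>\<close> follows from the boundedness and the Lipschitz continuity of \<open>f\<close>: the free drift does not move
  \<open>y\<close>, so that \<open>y\<close> moves by at most \<open>|h| sup |f|\<close> (\<open>perturbed_path_exists\<close>).
\<close>

section \<open>Functions with bounded continuous partial derivatives\<close>

text \<open>
  The mean value inequality for curves, to which the estimates of remainders, of the motion of \<open>y\<close>
  and of the distance of two solutions are reduced.
\<close>

lemma vector_derivative_bound:
  fixes \<phi> :: "real \<Rightarrow> 'a::real_normed_vector"
  assumes "convex S" "\<And>s. s \<in> S \<Longrightarrow> (\<phi> has_vector_derivative \<phi>' s) (at s within S)"
    and "\<And>s. s \<in> S \<Longrightarrow> norm (\<phi>' s) \<le> B" and "p \<in> S" "q \<in> S"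
  shows "norm (\<phi> p - \<phi> q) \<le> B * \<bar>p - q\<bar>"
proof -
  have "norm (\<phi> p - \<phi> q) \<le> B * norm (p - q)"
  proof (rule differentiable_bound[OF assms(1) _ _ assms(4,5)])
    fix s assume s: "s \<in> S"
    show "(\<phi> has_derivative (\<lambda>t. t *\<^sub>R \<phi>' s)) (at s within S)"
      using assms(2)[OF s] by (simp add: has_vector_derivative_def)
    have "norm (t *\<^sub>R \<phi>' s) \<le> B * norm t" for t :: real
      using mult_left_mono[OF assms(3)[OF s], of "\<bar>t\<bar>"] by (simp add: mult.commute)
    moreover have "0 \<le> B" using norm_ge_zero order_trans assms(3)[OF s] by blast
    ultimately show "onorm (\<lambda>t. t *\<^sub>R \<phi>' s) \<le> B" by (intro onorm_bound)
  qed
  then show ?thesis by simp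
qed

lemma partial_eqI:
  "((\<lambda>t. g (y + t *\<^sub>R axis i 1)) has_vector_derivative D) (at 0) \<Longrightarrow> partial i g y = D"
  unfolding partial_def by (rule vector_derivative_at)

lemma has_partial:
  "(\<lambda>t. g (y + t *\<^sub>R axis i 1)) differentiable (at 0) \<Longrightarrow>
   ((\<lambda>t. g (y + t *\<^sub>R axis i 1)) has_vector_derivative partial i g y) (at 0)"
  unfolding partial_def by (simp add: vector_derivative_works)

lemma bounded_Ck_imp_continuous_bounded:
  "bounded_Ck S B m g \<Longrightarrow> continuous_on B g \<and> bounded (g ` B)"
  by (cases m) auto

lemma bounded_Ck_Suc_imp: "bounded_Ck S B (Suc m) g \<Longrightarrow> bounded_Ck S B m g"
proof (induction m arbitrary: g)
  case (Suc m)
  then have "\<forall>i\<in>S. bounded_Ck S B m (partial i g)"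
    by (meson bounded_Ck.simps(2))
  with Suc.prems show ?case by simp
qed simp

lemma bounded_Ck_partial:
  assumes "bounded_Ck S B (Suc m) g" "i \<in> S"
  shows "continuous_on B (partial i g)" "bounded (partial i g ` B)"
  using assms bounded_Ck_imp_continuous_bounded[of S B m "partial i g"] by auto

lemma bounded_Ck_antimono: "bounded_Ck S B m g \<Longrightarrow> l \<le> m \<Longrightarrow> bounded_Ck S B l g"
proof (induction m)
  case (Suc m)
  then show ?case by (cases "l = Suc m") (auto simp del: bounded_Ck.simps dest: bounded_Ck_Suc_imp)
qed simp

lemma eventually_on_coordinate_line:
  fixes y :: "real ^ 'n::finite"
  assumes "open B" "y \<in> B"
  shows "\<forall>\<^sub>F t in nhds 0. y + t *\<^sub>R axis i 1 \<in> B"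
proof -
  have "((\<lambda>t. y + t *\<^sub>R axis i 1) \<longlongrightarrow> y + 0 *\<^sub>R axis i (1::real)) (nhds 0)"
    by (intro tendsto_intros filterlim_ident)
  then show ?thesis using topological_tendstoD[of _ y "nhds 0" B] assms by auto
qed

lemma has_vector_derivative_cong_open:
  fixes y :: "real ^ 'n::finite"
  assumes "open B" "y \<in> B" "\<And>x. x \<in> B \<Longrightarrow> f x = g x"
  shows "((\<lambda>t. f (y + t *\<^sub>R axis i 1)) has_vector_derivative D) (at 0) \<longleftrightarrow>
         ((\<lambda>t. g (y + t *\<^sub>R axis i 1)) has_vector_derivative D) (at 0)"
  using eventually_on_coordinate_line[OF assms(1,2), of i]
  by (intro has_vector_derivative_cong_ev refl) (auto elim!: eventually_mono simp: assms)

lemma partial_cong_open: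
  assumes "open B" "y \<in> B" "\<And>x. x \<in> B \<Longrightarrow> f x = g x"
  shows "partial i f y = partial i g y"
proof -
  have "(\<lambda>D. ((\<lambda>t. f (y + t *\<^sub>R axis i 1)) has_vector_derivative D) (at 0)) =
        (\<lambda>D. ((\<lambda>t. g (y + t *\<^sub>R axis i 1)) has_vector_derivative D) (at 0))"
    by (rule ext, rule has_vector_derivative_cong_open[OF assms])
  then show ?thesis unfolding partial_def vector_derivative_def by (rule arg_cong)
qed

text \<open>
  On an open set the partial derivatives depend only on values inside the set.  This allows products
  and other composite functions to be handled through formulas that are valid on the set only.
\<close>

lemma bounded_Ck_cong_open:
  assumes "open B" "\<And>x. x \<in> B \<Longrightarrow> f x = g x" "bounded_Ck S B m f"
  shows "bounded_Ck S B m g"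
  using assms(2,3)
proof (induction m arbitrary: f g)
  case 0
  then have "f ` B = g ` B" by (intro image_cong refl) auto
  moreover have "continuous_on B f = continuous_on B g" by (rule continuous_on_cong[OF refl 0(1)])
  ultimately show ?case using 0(2) by simp
next
  case (Suc m)
  have "f ` B = g ` B" using Suc.prems(1) by (intro image_cong refl) auto
  moreover have "continuous_on B f = continuous_on B g" by (rule continuous_on_cong[OF refl Suc.prems(1)])
  ultimately have "continuous_on B g" "bounded (g ` B)" using Suc.prems(2) by simp_all
  moreover have "(\<lambda>t. g (y + t *\<^sub>R axis i 1)) differentiable (at 0)" if "i \<in> S" "y \<in> B" for i y
  proof -
    have "((\<lambda>t. f (y + t *\<^sub>R axis i 1)) has_vector_derivative partial i f y) (at 0)"
      using Suc.prems that by (simp add: has_partial)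
    then have "((\<lambda>t. g (y + t *\<^sub>R axis i 1)) has_vector_derivative partial i f y) (at 0)"
      using has_vector_derivative_cong_open[where f = f and g = g, OF assms(1) that(2) Suc.prems(1)] by blast
    then show ?thesis by (rule differentiableI_vector)
  qed
  moreover have "bounded_Ck S B m (partial i g)" if "i \<in> S" for i
  proof (rule Suc.IH)
    show "partial i f x = partial i g x" if "x \<in> B" for x
      by (rule partial_cong_open[OF assms(1) that Suc.prems(1)])
    show "bounded_Ck S B m (partial i f)" using Suc.prems(2) that by simp
  qed
  ultimately show ?case by simp
qed

text \<open>
  The introduction rule for concrete functions, sums and products: it accepts any explicit formula
  for the partial derivatives in place of the derivatives themselves.
\<close>

lemma bounded_Ck_SucI:
  assumes "open B" "continuous_on B g" "bounded (g ` B)"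
    and "\<And>i y. i \<in> S \<Longrightarrow> y \<in> B \<Longrightarrow>
      ((\<lambda>t. g (y + t *\<^sub>R axis i 1)) has_vector_derivative D i y) (at 0)"
    and "\<And>i. i \<in> S \<Longrightarrow> bounded_Ck S B m (D i)"
  shows "bounded_Ck S B (Suc m) g"
proof -
  have "bounded_Ck S B m (partial i g)" if "i \<in> S" for i
    by (rule bounded_Ck_cong_open[OF assms(1) _ assms(5)[OF that]])
      (rule partial_eqI[OF assms(4)[OF that], symmetric])
  moreover have "(\<lambda>t. g (y + t *\<^sub>R axis i 1)) differentiable (at 0)" if "i \<in> S" "y \<in> B" for i y
    by (rule differentiableI_vector[OF assms(4)[OF that]])
  ultimately show ?thesis using assms(2,3) by simp
qed

lemma bounded_Ck_has_partial:
  "bounded_Ck S B (Suc m) g \<Longrightarrow> i \<in> S \<Longrightarrow> y \<in> B \<Longrightarrow>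
   ((\<lambda>t. g (y + t *\<^sub>R axis i 1)) has_vector_derivative partial i g y) (at 0)"
  by (auto intro: has_partial)

lemma bounded_Ck_zero: "open B \<Longrightarrow> bounded_Ck S B m (\<lambda>_. 0)"
proof (induction m)
  case 0
  then show ?case by (auto simp: bounded_iff)
next
  case (Suc m)
  show ?case
    by (rule bounded_Ck_SucI[where D = "\<lambda>_ _. 0"]) (use Suc in \<open>auto simp: bounded_iff\<close>)
qed

lemma bounded_Ck_add:
  assumes "open B" "bounded_Ck S B m f" "bounded_Ck S B m g"
  shows "bounded_Ck S B m (\<lambda>x. f x + g x)"
  using assms(2,3)
proof (induction m arbitrary: f g)
  case 0
  then show ?case by (auto intro!: continuous_intros bounded_plus_comp)
next
  case (Suc m)
  show ?case
  proof (rule bounded_Ck_SucI[where D = "\<lambda>i x. partial i f x + partial i g x", OF assms(1)])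
    show "bounded_Ck S B m (\<lambda>x. partial i f x + partial i g x)" if "i \<in> S" for i
      using Suc that by simp
    show "((\<lambda>t. f (y + t *\<^sub>R axis i 1) + g (y + t *\<^sub>R axis i 1)) has_vector_derivative
        partial i f y + partial i g y) (at 0)" if "i \<in> S" "y \<in> B" for i y
      by (intro has_vector_derivative_add bounded_Ck_has_partial[OF Suc.prems(1) that]
          bounded_Ck_has_partial[OF Suc.prems(2) that])
  qed (use Suc.prems in \<open>auto intro!: continuous_intros bounded_plus_comp\<close>)
qed

lemma bounded_Ck_sum:
  assumes "open B" "\<And>a. a \<in> A \<Longrightarrow> bounded_Ck S B m (f a)"
  shows "bounded_Ck S B m (\<lambda>x. \<Sum>a\<in>A. f a x)"
  using assms(2)
proof (induction A rule: infinite_finite_induct)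
  case (insert a A)
  then have "bounded_Ck S B m (\<lambda>x. f a x + (\<Sum>a\<in>A. f a x))"
    by (intro bounded_Ck_add[OF assms(1)]) auto
  with insert.hyps show ?case by simp
qed (simp_all add: bounded_Ck_zero[OF assms(1)])

lemma bounded_Ck_linear:
  assumes "open B" "bounded_linear L" "bounded_Ck S B m f"
  shows "bounded_Ck S B m (\<lambda>x. L (f x))"
  using assms(3)
proof (induction m arbitrary: f)
  case 0
  then show ?case
    using bounded_linear_image[OF _ assms(2), of "f ` B"]
    by (auto simp: image_image intro!: bounded_linear.continuous_on[OF assms(2)])
next
  case (Suc m)
  show ?case
  proof (rule bounded_Ck_SucI[where D = "\<lambda>i x. L (partial i f x)", OF assms(1)])
    show "((\<lambda>t. L (f (y + t *\<^sub>R axis i 1))) has_vector_derivative L (partial i f y)) (at 0)"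
      if "i \<in> S" "y \<in> B" for i y
      by (intro bounded_linear.has_vector_derivative[OF assms(2)] bounded_Ck_has_partial[OF Suc.prems that])
  qed (use Suc bounded_linear_image[OF _ assms(2), of "f ` B"]
     in \<open>auto simp: image_image intro!: bounded_linear.continuous_on[OF assms(2)]\<close>)
qed

lemma bounded_bilinear_bounded_image:
  assumes "bounded_bilinear P" "bounded (f ` B)" "bounded (g ` B)"
  shows "bounded ((\<lambda>x. P (f x) (g x)) ` B)"
proof -
  obtain K where K: "\<And>a b. norm (P a b) \<le> norm a * norm b * K" "K > 0"
    using bounded_bilinear.pos_bounded[OF assms(1)] by blast
  obtain F where F: "\<And>x. x \<in> B \<Longrightarrow> norm (f x) \<le> F" using assms(2) by (auto simp: bounded_iff)
  obtain G where G: "\<And>x. x \<in> B \<Longrightarrow> norm (g x) \<le> G" using assms(3) by (auto simp: bounded_iff)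
  have "norm (P (f x) (g x)) \<le> F * G * K" if "x \<in> B" for x
  proof -
    have "norm (f x) * norm (g x) \<le> F * G"
      using F[OF that] G[OF that] by (intro mult_mono) (auto intro: order_trans[OF norm_ge_zero])
    then show ?thesis using K(1)[of "f x" "g x"] K(2) by (meson less_imp_le mult_right_mono order_trans)
  qed
  then show ?thesis by (auto simp: bounded_iff)
qed

lemma bounded_Ck_bilinear:
  assumes "open B" "bounded_bilinear P" "bounded_Ck S B m f" "bounded_Ck S B m g"
  shows "bounded_Ck S B m (\<lambda>x. P (f x) (g x))"
  using assms(3,4)
proof (induction m arbitrary: f g)
  case 0
  then show ?case
    by (auto intro!: bounded_bilinear.continuous_on[OF assms(2)] bounded_bilinear_bounded_image[OF assms(2)])
next
  case (Suc m)
  note low = Suc.prems[THEN bounded_Ck_Suc_imp]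
  show ?case
  proof (rule bounded_Ck_SucI[where D = "\<lambda>i x. P (f x) (partial i g x) + P (partial i f x) (g x)", OF assms(1)])
    show "((\<lambda>t. P (f (y + t *\<^sub>R axis i 1)) (g (y + t *\<^sub>R axis i 1))) has_vector_derivative
        P (f y) (partial i g y) + P (partial i f y) (g y)) (at 0)"
      if "i \<in> S" "y \<in> B" for i y
      using bounded_bilinear.has_vector_derivative[OF assms(2) 
          bounded_Ck_has_partial[OF Suc.prems(1) that] bounded_Ck_has_partial[OF Suc.prems(2) that]]
      by simp
    show "bounded_Ck S B m (\<lambda>x. P (f x) (partial i g x) + P (partial i f x) (g x))" if "i \<in> S" for i
      using Suc.prems that by (intro bounded_Ck_add assms(1) Suc.IH low) auto
  qed (use Suc.prems in \<open>auto intro!: bounded_bilinear.continuous_on[OF assms(2)] bounded_bilinear_bounded_image[OF assms(2)]\<close>)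
qed

text \<open>
  The increment is followed along one coordinate axis at a time.  The base point \<open>p\<close> is allowed to
  vary near \<open>x\<close>, while the derivatives are taken at \<open>x\<close>: in the induction step the part of the
  increment along the other axes starts at \<open>p\<close> and the last part at a displaced point, and
  continuity of the partial derivatives makes both approximations uniform.
\<close>

lemma partials_approx_increment:
  fixes g :: "real ^ 'n::finite \<Rightarrow> 'a::real_normed_vector"
  assumes "open B" "x \<in> B"
    and diff: "\<And>i y. y \<in> B \<Longrightarrow> (\<lambda>t. g (y + t *\<^sub>R axis i 1)) differentiable (at 0)"
    and cont: "\<And>i. continuous_on B (partial i g)"
    and "finite A" "\<epsilon> > 0"
  shows "\<exists>\<delta>>0. \<forall>p v. dist p x < \<delta> \<longrightarrow> norm v < \<delta> \<longrightarrow> (\<forall>i. i \<notin> A \<longrightarrow> v $ i = 0) \<longrightarrow>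
           norm (g (p + v) - g p - (\<Sum>i\<in>A. (v $ i) *\<^sub>R partial i g x)) \<le> \<epsilon> * norm v"
  using assms(5,6)
proof (induction A arbitrary: \<epsilon> rule: finite_induct)
  case empty
  show ?case
  proof (intro exI[of _ 1] conjI allI impI)
    fix p v :: "real ^ 'n" assume "\<forall>i. i \<notin> {} \<longrightarrow> v $ i = 0"
    then have "v = 0" by (simp add: vec_eq_iff)
    then show "norm (g (p + v) - g p - (\<Sum>i\<in>{}. (v $ i) *\<^sub>R partial i g x)) \<le> \<epsilon> * norm v" by simp
  qed simp
next
  case (insert j A)
  obtain \<delta>1 where \<delta>1: "\<delta>1 > 0"
    "\<forall>p v. dist p x < \<delta>1 \<longrightarrow> norm v < \<delta>1 \<longrightarrow> (\<forall>i. i \<notin> A \<longrightarrow> v $ i = 0) \<longrightarrow>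
        norm (g (p + v) - g p - (\<Sum>i\<in>A. (v $ i) *\<^sub>R partial i g x)) \<le> \<epsilon>/2 * norm v"
    using insert.IH[OF half_gt_zero[OF insert.prems]] by (elim exE conjE)
  obtain \<delta>2 where \<delta>2: "\<delta>2 > 0" "ball x \<delta>2 \<subseteq> B"
    using assms(1,2) open_contains_ball_eq by blast
  have "continuous (at x) (partial j g)"
    using cont assms(1,2) continuous_on_eq_continuous_at by blast
  then obtain \<delta>3 where \<delta>3: "\<delta>3 > 0"
    "\<And>y. dist y x < \<delta>3 \<Longrightarrow> dist (partial j g y) (partial j g x) < \<epsilon>/2"
    using insert.prems unfolding continuous_at_eps_delta by (meson half_gt_zero)
  \<comment> \<open>The points met on the path differ from \<open>x\<close> by three vectors of norm less than \<open>\<delta>\<close>.\<close>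
  define \<delta> where "\<delta> = Min {\<delta>1, \<delta>2, \<delta>3} / 3"
  have "\<delta> > 0" using \<delta>1(1) \<delta>2(1) \<delta>3(1) by (simp add: \<delta>_def)
  have le: "3 * \<delta> \<le> \<delta>1" "3 * \<delta> \<le> \<delta>2" "3 * \<delta> \<le> \<delta>3" by (simp_all add: \<delta>_def)
  show ?case
  proof (intro exI[of _ \<delta>] conjI allI impI)
    fix p v :: "real ^ 'n"
    assume p: "dist p x < \<delta>" and v: "norm v < \<delta>" and v0: "\<forall>i. i \<notin> insert j A \<longrightarrow> v $ i = 0"
    \<comment> \<open>The path from \<open>p\<close> to \<open>p + v\<close> first makes the step \<open>u\<close> along the axes in \<open>A\<close>, then moves along axis \<open>j\<close>.\<close>
    define u where "u = v - (v $ j) *\<^sub>R axis j 1"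
    have u0: "u $ i = 0" if "i \<notin> A" for i
      using v0 that by (cases "i = j") (auto simp: u_def axis_def)
    have ui: "u $ i = v $ i" if "i \<in> A" for i
      using insert.hyps that by (auto simp: u_def axis_def)
    have "norm u \<le> norm v"
    proof (rule norm_le_componentwise_cart)
      fix i show "norm (u $ i) \<le> norm (v $ i)" using v0 by (cases "i = j") (auto simp: u_def axis_def)
    qed
    have vj: "\<bar>v $ j\<bar> \<le> norm v" by (rule component_le_norm_cart)
    let ?\<psi> = "\<lambda>s. g (p + u + s *\<^sub>R axis j 1) - s *\<^sub>R partial j g x"
    have near: "dist (p + u + s *\<^sub>R axis j 1) x < 3 * \<delta>" if "\<bar>s\<bar> \<le> \<bar>v $ j\<bar>" for s
    proof -
      have "norm ((p - x) + u + s *\<^sub>R axis j 1) \<le> norm (p - x) + norm u + norm (s *\<^sub>R axis j (1::real))"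
        using norm_triangle_ineq[of "(p - x) + u" "s *\<^sub>R axis j 1"] norm_triangle_ineq[of "p - x" u] by linarith
      also have "\<dots> < 3 * \<delta>"
        using p v \<open>norm u \<le> norm v\<close> vj that by (simp add: dist_norm)
      finally show ?thesis by (simp add: dist_norm algebra_simps)
    qed
    have "norm (?\<psi> (v $ j) - ?\<psi> 0) \<le> \<epsilon>/2 * \<bar>v $ j - 0\<bar>"
    proof (rule vector_derivative_bound)
      show "convex (closed_segment 0 (v $ j))" by (rule convex_closed_segment)
      fix s assume "s \<in> closed_segment 0 (v $ j)"
      then have s: "\<bar>s\<bar> \<le> \<bar>v $ j\<bar>" by (auto simp: closed_segment_eq_real_ivl split: if_splits)
      let ?q = "p + u + s *\<^sub>R axis j 1"
      have q: "?q \<in> B" using near[OF s] le \<delta>2(2) by (auto simp: subset_eq dist_commute)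
      have "((\<lambda>t. g (?q + t *\<^sub>R axis j 1)) has_vector_derivative partial j g ?q) (at (s - s))"
        using has_partial[OF diff[OF q]] by simp
      then have "((\<lambda>t. g (?q + t *\<^sub>R axis j 1)) \<circ> (\<lambda>t. t - s) has_vector_derivative 1 *\<^sub>R partial j g ?q) (at s)"
        by (intro vector_diff_chain_at) (auto intro!: derivative_eq_intros)
      moreover have "((\<lambda>t. g (?q + t *\<^sub>R axis j 1)) \<circ> (\<lambda>t. t - s)) = (\<lambda>t. g (p + u + t *\<^sub>R axis j 1))"
        by (auto simp: fun_eq_iff algebra_simps)
      ultimately have "((\<lambda>t. g (p + u + t *\<^sub>R axis j 1)) has_vector_derivative partial j g ?q)
          (at s within closed_segment 0 (v $ j))"
        by (simp add: has_vector_derivative_at_within)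
      then show "(?\<psi> has_vector_derivative partial j g ?q - partial j g x) (at s within closed_segment 0 (v $ j))"
        by (auto intro!: derivative_eq_intros)
      show "norm (partial j g ?q - partial j g x) \<le> \<epsilon>/2"
        using \<delta>3(2)[of ?q] near[OF s] le by (simp add: dist_norm)
    qed auto
    also have "\<epsilon>/2 * \<bar>v $ j - 0\<bar> \<le> \<epsilon>/2 * norm v"
      using mult_left_mono[OF vj, of "\<epsilon>/2"] insert.prems by simp
    finally have 1: "norm (g (p + v) - g (p + u) - (v $ j) *\<^sub>R partial j g x) \<le> \<epsilon>/2 * norm v"
      by (simp add: u_def algebra_simps)
    have 2: "norm (g (p + u) - g p - (\<Sum>i\<in>A. (v $ i) *\<^sub>R partial i g x)) \<le> \<epsilon>/2 * norm v"
    proof -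
      have "norm (g (p + u) - g p - (\<Sum>i\<in>A. (u $ i) *\<^sub>R partial i g x)) \<le> \<epsilon>/2 * norm u"
        using p v \<open>norm u \<le> norm v\<close> le \<open>\<delta> > 0\<close> u0 by (intro \<delta>1(2)[rule_format]) auto
      also have "\<dots> \<le> \<epsilon>/2 * norm v"
        using \<open>norm u \<le> norm v\<close> insert.prems by (intro mult_left_mono) auto
      finally show ?thesis using ui by simp
    qed
    have "g (p + v) - g p - (\<Sum>i\<in>insert j A. (v $ i) *\<^sub>R partial i g x) =
        (g (p + v) - g (p + u) - (v $ j) *\<^sub>R partial j g x) +
        (g (p + u) - g p - (\<Sum>i\<in>A. (v $ i) *\<^sub>R partial i g x))"
      using insert.hyps by simp
    also have "norm \<dots> \<le> \<epsilon> * norm v"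
      using norm_triangle_le[OF add_mono[OF 1 2]] by simp
    finally show "norm (g (p + v) - g p - (\<Sum>i\<in>insert j A. (v $ i) *\<^sub>R partial i g x)) \<le> \<epsilon> * norm v" .
  qed (use \<open>\<delta> > 0\<close> in auto)
qed

lemma continuous_partials_imp_has_derivative:
  fixes g :: "real ^ 'n::finite \<Rightarrow> 'a::real_normed_vector"
  assumes "open B" "x \<in> B"
    and "\<And>i y. y \<in> B \<Longrightarrow> (\<lambda>t. g (y + t *\<^sub>R axis i 1)) differentiable (at 0)"
    and "\<And>i. continuous_on B (partial i g)"
  shows "(g has_derivative (\<lambda>v. \<Sum>i\<in>UNIV. (v $ i) *\<^sub>R partial i g x)) (at x)"
  unfolding has_derivative_at_alt
proof (intro conjI allI impI)
  show "bounded_linear (\<lambda>v. \<Sum>i\<in>UNIV. (v $ i) *\<^sub>R partial i g x)"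
    by (intro bounded_linear_sum bounded_linear_scaleR_const bounded_linear_vec_nth)
  fix e :: real assume "0 < e"
  have "\<exists>\<delta>>0. \<forall>p v. dist p x < \<delta> \<longrightarrow> norm v < \<delta> \<longrightarrow> (\<forall>i. i \<notin> UNIV \<longrightarrow> v $ i = 0) \<longrightarrow>
      norm (g (p + v) - g p - (\<Sum>i\<in>UNIV. (v $ i) *\<^sub>R partial i g x)) \<le> e * norm v"
    by (rule partials_approx_increment[OF assms(1,2) _ _ finite \<open>0 < e\<close>]; fact)
  then obtain \<delta> where "\<delta> > 0" and \<delta>: "\<forall>p v. dist p x < \<delta> \<longrightarrow> norm v < \<delta> \<longrightarrow>
      (\<forall>i. i \<notin> UNIV \<longrightarrow> v $ i = 0) \<longrightarrow>
      norm (g (p + v) - g p - (\<Sum>i\<in>UNIV. (v $ i) *\<^sub>R partial i g x)) \<le> e * norm v"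
    by (elim exE conjE)
  from \<delta>[rule_format, of x "y - x" for y] \<open>\<delta> > 0\<close> show "\<exists>d>0. \<forall>y. norm (y - x) < d \<longrightarrow>
      norm (g y - g x - (\<Sum>i\<in>UNIV. ((y - x) $ i) *\<^sub>R partial i g x)) \<le> e * norm (y - x)"
    by (intro exI[of _ \<delta>]) simp
qed

lemma bounded_Ck_has_derivative:
  assumes "open B" "x \<in> B" "bounded_Ck UNIV B (Suc m) g"
  shows "(g has_derivative (\<lambda>v. \<Sum>i\<in>UNIV. (v $ i) *\<^sub>R partial i g x)) (at x)"
proof (rule continuous_partials_imp_has_derivative[OF assms(1,2)])
  show "(\<lambda>t. g (y + t *\<^sub>R axis i 1)) differentiable (at 0)" if "y \<in> B" for i y
    using assms(3) that by simp
  show "continuous_on B (partial i g)" for i by (rule bounded_Ck_partial[OF assms(3) UNIV_I])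
qed

lemma bounded_Ck_Lipschitz:
  fixes g :: "real ^ 'n::finite \<Rightarrow> 'a::real_normed_vector"
  assumes "open B" "convex B" "bounded_Ck UNIV B (Suc m) g"
  obtains L where "L \<ge> 0" "\<And>x y. x \<in> B \<Longrightarrow> y \<in> B \<Longrightarrow> norm (g x - g y) \<le> L * norm (x - y)"
proof -
  have "\<exists>M. \<forall>x\<in>B. norm (partial i g x) \<le> M" for i
    using bounded_Ck_partial(2)[OF assms(3) UNIV_I, of i] by (auto simp: bounded_iff)
  then obtain M where M: "\<And>i x. x \<in> B \<Longrightarrow> norm (partial i g x) \<le> M i" by metis
  let ?L = "\<Sum>i\<in>UNIV. \<bar>M i\<bar>"
  have "norm (g x - g y) \<le> ?L * norm (x - y)" if "x \<in> B" "y \<in> B" for x y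
  proof (rule differentiable_bound[OF assms(2) _ _ that])
    fix z assume z: "z \<in> B"
    show "(g has_derivative (\<lambda>v. \<Sum>i\<in>UNIV. (v $ i) *\<^sub>R partial i g z)) (at z within B)"
      using bounded_Ck_has_derivative[OF assms(1) z assms(3)] has_derivative_at_withinI by blast
    show "onorm (\<lambda>v. \<Sum>i\<in>UNIV. (v $ i) *\<^sub>R partial i g z) \<le> ?L"
    proof (rule onorm_bound)
      fix v :: "real ^ 'n"
      have "norm (\<Sum>i\<in>UNIV. (v $ i) *\<^sub>R partial i g z) \<le> (\<Sum>i\<in>UNIV. \<bar>M i\<bar> * norm v)"
      proof (rule sum_norm_le)
        fix i
        have "norm (partial i g z) \<le> \<bar>M i\<bar>" using M[OF z, of i] by linarith
        then show "norm ((v $ i) *\<^sub>R partial i g z) \<le> \<bar>M i\<bar> * norm v"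
          using mult_mono[OF component_le_norm_cart[of v i], of "norm (partial i g z)" "\<bar>M i\<bar>"]
          by (simp add: mult.commute)
      qed
      then show "norm (\<Sum>i\<in>UNIV. (v $ i) *\<^sub>R partial i g z) \<le> ?L * norm v"
        by (simp add: sum_distrib_right)
    qed (simp add: sum_nonneg)
  qed
  then show thesis using that[of ?L] by (simp add: sum_nonneg)
qed

section \<open>Complex vectors and the phase space\<close>

lemma norm_complex_smult: "norm (c *s (v :: complex ^ 'n)) = cmod c * norm v"
  by (simp add: norm_vec_def norm_mult L2_set_right_distrib)

lemma of_real_smult: "complex_of_real r *s (v :: complex ^ 'n) = r *\<^sub>R v"
  unfolding vec_eq_iff by (simp add: scaleR_conv_of_real[symmetric])

lemma bounded_bilinear_complex_smult:
  "bounded_bilinear (\<lambda>c (v :: complex ^ 'n). c *s v)"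
  by (rule bounded_bilinear.intro)
    (auto simp: vec_eq_iff algebra_simps norm_complex_smult intro!: exI[of _ 1])

lemma norm_cvec: "norm (cvec v) = norm v"
  by (simp add: cvec_def norm_vec_def)

lemma bounded_linear_cvec: "bounded_linear cvec"
  by (rule bounded_linear_intro[where K = 1])
    (auto simp add: norm_cvec, simp_all add: cvec_def vec_eq_iff complex_eq_iff)

lemma matrix_vector_mult_sum:
  "(A :: complex ^ 'n ^ 'm) *v (\<Sum>a\<in>S. g a) = (\<Sum>a\<in>S. A *v g a)"
  by (induction S rule: infinite_finite_induct) (simp_all add: matrix_vector_right_distrib)

lemma bounded_linear_ypart: "bounded_linear (ypart ang)"
  unfolding linear_conv_bounded_linear[symmetric]
  by (rule linearI) (auto simp: ypart_def vec_eq_iff)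

lemma ypart_add_axis:
  "ypart ang (x + t *\<^sub>R axis i 1) = ypart ang x + (if i \<in> range ang then 0 else t) *\<^sub>R axis i 1"
  by (auto simp: ypart_def vec_eq_iff axis_def)

lemma kdot_add_axis:
  assumes "inj ang"
  shows "kdot k (angles ang (x + t *\<^sub>R axis i 1)) =
    kdot k (angles ang x) + t * (if i \<in> range ang then of_int (k $ inv ang i) else 0)"
proof -
  have "kdot k (angles ang (x + t *\<^sub>R axis i 1)) =
      kdot k (angles ang x) + (\<Sum>j\<in>UNIV. of_int (k $ j) * (t * axis i 1 $ ang j))"
    by (simp add: kdot_def angles_def algebra_simps sum.distrib)
  also have "(\<Sum>j\<in>UNIV. of_int (k $ j) * (t * axis i 1 $ ang j)) =
      t * (if i \<in> range ang then of_int (k $ inv ang i) else 0)"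
  proof (cases "i \<in> range ang")
    case True
    then have "axis i 1 $ ang j = (if j = inv ang i then 1 else (0::real))" for j
      using assms by (auto simp: axis_def inv_f_f inj_eq)
    then show ?thesis using True by (simp add: if_distrib[of "\<lambda>x. _ * (_ * x)"] cong: if_cong)
  next
    case False
    then have "axis i 1 $ ang j = (0::real)" for j by (auto simp: axis_def)
    with False show ?thesis by simp
  qed
  finally show ?thesis .
qed

lemma ypart_in_yspace: "ypart ang x \<in> yspace ang"
  by (simp add: ypart_def yspace_def)

lemma phase_domain_iff: "x \<in> phase_domain ang y0 R \<longleftrightarrow> norm (ypart ang x - y0) < R"
  by (simp add: phase_domain_def yball_def ypart_in_yspace)

lemma phase_domain_vimage_ball: "phase_domain ang y0 R = ypart ang -` ball y0 R"
  by (auto simp: phase_domain_iff dist_norm norm_minus_commute)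

lemma open_phase_domain: "open (phase_domain ang y0 R)"
  unfolding phase_domain_vimage_ball
  by (intro open_vimage open_ball bounded_linear.continuous_on[OF bounded_linear_ypart] continuous_on_id)

lemma convex_phase_domain: "convex (phase_domain ang y0 R)"
  unfolding phase_domain_vimage_ball
  by (intro convex_linear_vimage convex_ball bounded_linear.linear[OF bounded_linear_ypart])

text \<open>
  Transfers the smoothness of the Fourier coefficients from the ball of the \<open>y\<close>-space, where only
  derivatives in the non-angle directions make sense, to the open set \<open>\<Omega>\<close> of the full space, where
  Frechet derivatives exist; derivatives in the angle directions vanish.
\<close>

lemma bounded_Ck_comp_ypart:
  fixes g :: "real ^ 'n::finite \<Rightarrow> 'a::real_normed_vector"
  assumes "bounded_Ck (- range ang) (yball ang y0 R) m g"
  shows "bounded_Ck UNIV (phase_domain ang y0 R) m (\<lambda>x. g (ypart ang x))"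
  using assms
proof (induction m arbitrary: g)
  case 0
  have "ypart ang ` phase_domain ang y0 R \<subseteq> yball ang y0 R"
    by (auto simp: phase_domain_def)
  then show ?case
    using 0 bounded_linear.continuous_on[OF bounded_linear_ypart continuous_on_id]
    by (auto intro!: continuous_on_compose2[of "yball ang y0 R" g] intro: bounded_subset)
next
  case (Suc m)
  let ?\<Omega> = "phase_domain ang y0 R"
  have low: "bounded_Ck UNIV ?\<Omega> m (\<lambda>x. g (ypart ang x))"
    using Suc.IH Suc.prems bounded_Ck_Suc_imp by blast
  show ?case
  proof (rule bounded_Ck_SucI[OF open_phase_domain])
    show "continuous_on ?\<Omega> (\<lambda>x. g (ypart ang x))" "bounded ((\<lambda>x. g (ypart ang x)) ` ?\<Omega>)"
      using bounded_Ck_imp_continuous_bounded[OF low] by auto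
    fix i
    let ?D = "\<lambda>i x. if i \<in> range ang then 0 else partial i g (ypart ang x)"
    show "((\<lambda>t. g (ypart ang (x + t *\<^sub>R axis i 1))) has_vector_derivative ?D i x) (at 0)"
      if "x \<in> ?\<Omega>" for x
    proof (cases "i \<in> range ang")
      case True
      then show ?thesis by (simp add: ypart_add_axis)
    next
      case False
      then have "((\<lambda>t. g (ypart ang x + t *\<^sub>R axis i 1)) has_vector_derivative partial i g (ypart ang x)) (at 0)"
        using that by (intro bounded_Ck_has_partial[OF Suc.prems]) (auto simp: phase_domain_def)
      then show ?thesis using False by (simp add: ypart_add_axis)
    qed
    show "bounded_Ck UNIV ?\<Omega> m (?D i)"
    proof (cases "i \<in> range ang")
      case True
      then show ?thesis by (simp add: bounded_Ck_zero[OF open_phase_domain])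
    next
      case False
      then show ?thesis using Suc.IH[of "partial i g"] Suc.prems by simp
    qed
  qed
qed

text \<open>
  A partial derivative of a character is a constant times the same character, so the induction has
  to run over all constant factors \<open>c\<close>.
\<close>

lemma bounded_Ck_character:
  assumes "inj ang" "open B"
  shows "bounded_Ck UNIV B m (\<lambda>x. c * exp (\<i> * complex_of_real (kdot k (angles ang x))))"
proof (induction m arbitrary: c)
  case 0
  have "continuous_on B (\<lambda>x. c * exp (\<i> * complex_of_real (kdot k (angles ang x))))"
    unfolding kdot_def angles_def by (intro continuous_intros)
  then show ?case by (auto simp: bounded_iff norm_mult intro!: exI[of _ "cmod c"])
next
  case (Suc m)
  let ?\<kappa> = "\<lambda>i. if i \<in> range ang then of_int (k $ inv ang i) else (0::real)"
  show ?case
  proof (rule bounded_Ck_SucI[OF assms(2)])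
    fix i
    show "((\<lambda>t. c * exp (\<i> * complex_of_real (kdot k (angles ang (x + t *\<^sub>R axis i 1))))) has_vector_derivative
        (c * (\<i> * ?\<kappa> i)) * exp (\<i> * complex_of_real (kdot k (angles ang x)))) (at 0)" for x
    proof -
      have "((\<lambda>s. exp (\<i> * (kdot k (angles ang x) + s * complex_of_real (?\<kappa> i)))) has_field_derivative
        (\<i> * ?\<kappa> i) * exp (\<i> * (kdot k (angles ang x) + of_real 0 * complex_of_real (?\<kappa> i)))) (at (of_real 0))"
        by (auto intro!: derivative_eq_intros)
      then have "((\<lambda>t. exp (\<i> * (kdot k (angles ang x) + complex_of_real t * ?\<kappa> i))) has_vector_derivative
        (\<i> * ?\<kappa> i) * exp (\<i> * (kdot k (angles ang x) + of_real 0 * complex_of_real (?\<kappa> i)))) (at 0)"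
        by (rule has_vector_derivative_real_field)
      then show ?thesis
        unfolding kdot_add_axis[OF assms(1)]
        using has_vector_derivative_mult_right[of _ _ "at 0" c] by (simp add: mult.assoc)
    qed
    show "bounded_Ck UNIV B m (\<lambda>x. (c * (\<i> * ?\<kappa> i)) * exp (\<i> * complex_of_real (kdot k (angles ang x))))"
      by (rule Suc)
  qed (use bounded_Ck_imp_continuous_bounded[OF Suc[of c]] in simp_all)
qed

lemma cjacobian_mult_vec:
  fixes g :: "real ^ 'n::finite \<Rightarrow> complex ^ 'm::finite"
  assumes "open B" "x \<in> B" "bounded_Ck UNIV B (Suc m) g"
  shows "cjacobian g x *v u = (\<Sum>j\<in>UNIV. u $ j *s partial j g x)"
proof -
  have "frechet_derivative g (at x) = (\<lambda>v. \<Sum>i\<in>UNIV. (v $ i) *\<^sub>R partial i g x)"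
    using frechet_derivative_at[OF bounded_Ck_has_derivative[OF assms]] by simp
  then have "frechet_derivative g (at x) (axis j 1) = partial j g x" for j
    by (simp add: axis_def if_distrib[of "\<lambda>a. a *\<^sub>R _"] cong: if_cong)
  then show ?thesis
    by (simp add: cjacobian_def matrix_vector_mult_def vec_eq_iff mult.commute)
qed


section \<open>Word-basis functions along a curve\<close>

locale oscillatory_field =
  fixes ang :: "'d::finite \<Rightarrow> 'n::finite"
    and f :: "real ^ 'n \<Rightarrow> real ^ 'n"
    and fhat :: "int ^ 'd \<Rightarrow> real ^ 'n \<Rightarrow> complex ^ 'n"
    and y0 :: "real ^ 'n" and R :: real
    and I :: "(int ^ 'd) set" and N :: nat
  assumes inj_ang: "inj ang"
    and y0: "y0 \<in> yspace ang" and R_pos: "R > 0"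
    and fourier: "\<And>x. x \<in> phase_domain ang y0 R \<Longrightarrow> ((\<lambda>k. mode ang fhat k x) has_sum cvec (f x)) UNIV"
    and conj_sym: "\<And>k y i. y \<in> yball ang y0 R \<Longrightarrow> fhat (- k) y $ i = cnj (fhat k y $ i)"
    and finite_I: "finite I"
    and support: "\<And>k y. k \<notin> I \<Longrightarrow> y \<in> yball ang y0 R \<Longrightarrow> fhat k y = 0"
    and N_ge_2: "N \<ge> 2"
    and smooth: "\<And>k. bounded_Ck (- range ang) (yball ang y0 R) (N - 1) (fhat k)"
begin

abbreviation \<Omega> where "\<Omega> \<equiv> phase_domain ang y0 R"

lemmas open_\<Omega> = open_phase_domain[of ang y0 R]

lemma bounded_Ck_mode: "bounded_Ck UNIV \<Omega> (N - 1) (mode ang fhat k)"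
proof -
  have "mode ang fhat k = (\<lambda>x. exp (\<i> * complex_of_real (kdot k (angles ang x))) *s fhat k (ypart ang x))"
    by (rule ext) (simp add: mode_def)
  moreover have "bounded_Ck UNIV \<Omega> (N - 1)
      (\<lambda>x. exp (\<i> * complex_of_real (kdot k (angles ang x))) *s fhat k (ypart ang x))"
    using bounded_Ck_character[OF inj_ang open_\<Omega>, of "N - 1" 1 k]
    by (intro bounded_Ck_bilinear[OF open_\<Omega> bounded_bilinear_complex_smult]
        bounded_Ck_comp_ypart smooth) simp
  ultimately show ?thesis by simp
qed

lemma word_basis_Cons:
  assumes "bounded_Ck UNIV \<Omega> (Suc m) (word_basis ang fhat (l # w))" "x \<in> \<Omega>"
  shows "word_basis ang fhat (k # l # w) x =
    (\<Sum>j\<in>UNIV. (mode ang fhat k x $ j) *s partial j (word_basis ang fhat (l # w)) x)"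
  by (simp add: cjacobian_mult_vec[OF open_\<Omega> assms(2,1)])

text \<open>
  Each further letter costs one derivative.  Starting from the \<open>N - 1\<close> derivatives of the modes,
  words of length less than \<open>N\<close> are differentiable and words of length \<open>N\<close> are still bounded, which
  is exactly what an expansion with remainder of order \<open>N\<close> requires.
\<close>

lemma bounded_Ck_word_basis:
  "w \<noteq> [] \<Longrightarrow> length w \<le> N \<Longrightarrow> bounded_Ck UNIV \<Omega> (N - length w) (word_basis ang fhat w)"
proof (induction w rule: induct_list012)
  case (2 k)
  then show ?case using bounded_Ck_mode by simp
next
  case (3 k l w)
  let ?m = "N - length (k # l # w)"
  have eq: "N - length (l # w) = Suc ?m" using 3 by simp
  then have tail: "bounded_Ck UNIV \<Omega> (Suc ?m) (word_basis ang fhat (l # w))"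
    using 3(2)[OF list.discI] 3(4) by (simp only: eq[symmetric]) simp
  have "bounded_Ck UNIV \<Omega> ?m
      (\<lambda>x. \<Sum>j\<in>UNIV. (mode ang fhat k x $ j) *s partial j (word_basis ang fhat (l # w)) x)"
  proof (intro bounded_Ck_sum[OF open_\<Omega>] bounded_Ck_bilinear[OF open_\<Omega> bounded_bilinear_complex_smult]
      bounded_Ck_linear[OF open_\<Omega> bounded_linear_vec_nth])
    show "bounded_Ck UNIV \<Omega> ?m (mode ang fhat k)"
      by (rule bounded_Ck_antimono[OF bounded_Ck_mode]) simp
    show "bounded_Ck UNIV \<Omega> ?m (partial j (word_basis ang fhat (l # w)))" for j
      using tail by simp
  qed
  then show ?case
    by (rule bounded_Ck_cong_open[OF open_\<Omega>, rotated]) (rule word_basis_Cons[OF tail, symmetric])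
qed simp

text \<open>
  The empty word stands for the identity map.  Its derivative along \<open>f\<^sub>k\<close> is \<open>f\<^sub>k\<close>, so the relation
  between \<open>w\<close> and \<open>k # w\<close> extends to it, and the solution itself is expanded like any other \<open>f\<^sub>w\<close>.
\<close>

definition extended_basis :: "(int ^ 'd) list \<Rightarrow> real ^ 'n \<Rightarrow> complex ^ 'n" where
  "extended_basis w = (if w = [] then cvec else word_basis ang fhat w)"

lemma extended_basis_simps: 
  "extended_basis [] = cvec" "w \<noteq> [] \<Longrightarrow> extended_basis w = word_basis ang fhat w"
  by (simp_all add: extended_basis_def)

text \<open>
  The chain rule; complex coefficients enter because the real velocity \<open>z'\<close> is written as a complex
  combination of modes, to which the complex-linear Jacobian is applied term by term.
\<close>

lemma extended_basis_has_vector_derivative: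
  assumes "length w < N" "z t \<in> \<Omega>"
    and z: "(z has_vector_derivative z') (at t within T)"
    and z': "cvec z' = (\<Sum>k\<in>I. \<alpha> k *s mode ang fhat k (z t))"
  shows "((\<lambda>t. extended_basis w (z t)) has_vector_derivative
    (\<Sum>k\<in>I. \<alpha> k *s extended_basis (k # w) (z t))) (at t within T)"
proof (cases w)
  case Nil
  then show ?thesis
    using bounded_linear.has_vector_derivative[OF bounded_linear_cvec z]
    by (simp add: extended_basis_simps z')
next
  case (Cons l v)
  have "bounded_Ck UNIV \<Omega> (Suc (N - Suc (length w))) (word_basis ang fhat w)"
    using bounded_Ck_word_basis[of w] assms(1) Cons by (simp add: Suc_diff_Suc del: bounded_Ck.simps)
  note smooth_w = this[unfolded Cons]
  have "((\<lambda>t. word_basis ang fhat w (z t)) has_vector_derivative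
      (\<Sum>i\<in>UNIV. (z' $ i) *\<^sub>R partial i (word_basis ang fhat w) (z t))) (at t within T)"
    using diff_chain_within[OF z[unfolded has_vector_derivative_def]
        has_derivative_at_withinI[OF bounded_Ck_has_derivative[OF open_\<Omega> assms(2) smooth_w]]]
    by (simp add: Cons has_vector_derivative_def o_def scaleR_sum_right)
  also have "(\<Sum>i\<in>UNIV. (z' $ i) *\<^sub>R partial i (word_basis ang fhat w) (z t)) =
      cjacobian (word_basis ang fhat w) (z t) *v cvec z'"
    by (simp add: Cons cjacobian_mult_vec[OF open_\<Omega> assms(2) smooth_w] cvec_def of_real_smult)
  also have "\<dots> = (\<Sum>k\<in>I. \<alpha> k *s (cjacobian (word_basis ang fhat w) (z t) *v mode ang fhat k (z t)))"
    by (simp add: z' matrix_vector_mult_sum vector_scalar_commute)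
  also have "\<dots> = (\<Sum>k\<in>I. \<alpha> k *s extended_basis (k # w) (z t))"
    by (simp add: extended_basis_def Cons)
  finally show ?thesis by (simp add: extended_basis_def Cons)
qed

lemma extended_basis_bounded:
  obtains C where "C > 0" "\<And>w x. set w \<subseteq> I \<Longrightarrow> length w = N \<Longrightarrow> x \<in> \<Omega> \<Longrightarrow> norm (extended_basis w x) \<le> C"
proof -
  let ?W = "{w. set w \<subseteq> I \<and> length w = N}"
  have "\<exists>C. \<forall>x\<in>\<Omega>. norm (extended_basis w x) \<le> C" if "length w = N" for w
  proof -
    have "w \<noteq> []" using that N_ge_2 by auto
    then have "bounded (word_basis ang fhat w ` \<Omega>)"
      using bounded_Ck_imp_continuous_bounded[OF bounded_Ck_word_basis[of w]] that by simp
    then show ?thesis using \<open>w \<noteq> []\<close> by (simp add: extended_basis_def bounded_iff)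
  qed
  then have "\<exists>C. length w = N \<longrightarrow> (\<forall>x\<in>\<Omega>. norm (extended_basis w x) \<le> C)" for w by blast
  then obtain C where C: "\<And>w. length w = N \<longrightarrow> (\<forall>x\<in>\<Omega>. norm (extended_basis w x) \<le> C w)"
    using choice[of "\<lambda>w C. length w = N \<longrightarrow> (\<forall>x\<in>\<Omega>. norm (extended_basis w x) \<le> C)"] by blast
  have fin: "finite ?W" using finite_lists_length_eq[OF finite_I] by simp
  show thesis
  proof (rule that[of "1 + (\<Sum>w\<in>?W. \<bar>C w\<bar>)"])
    show "0 < 1 + (\<Sum>w\<in>?W. \<bar>C w\<bar>)" by (simp add: add_pos_nonneg sum_nonneg)
    show "norm (extended_basis w x) \<le> 1 + (\<Sum>w\<in>?W. \<bar>C w\<bar>)" 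
      if "set w \<subseteq> I" "length w = N" "x \<in> \<Omega>" for w x
    proof -
      have "norm (extended_basis w x) \<le> C w" using C[of w] that by blast
      moreover have "\<bar>C w\<bar> \<le> (\<Sum>w\<in>?W. \<bar>C w\<bar>)" using that fin by (intro member_le_sum) auto
      ultimately show ?thesis by linarith
    qed
  qed
qed

lemma mode_add_angles:
  "mode ang fhat k (x + state ang 0 \<theta>) = exp (\<i> * complex_of_real (kdot k \<theta>)) *s mode ang fhat k x"
proof -
  have "ypart ang (x + state ang 0 \<theta>) = ypart ang x" by (auto simp: ypart_def state_def vec_eq_iff)
  moreover have "kdot k (angles ang (x + state ang 0 \<theta>)) = kdot k (angles ang x) + kdot k \<theta>"
    by (simp add: kdot_def angles_def state_def inv_f_f[OF inj_ang] sum.distrib algebra_simps)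
  ultimately show ?thesis by (simp add: mode_def exp_add algebra_simps)
qed

lemma field_eq_sum_modes: "x \<in> \<Omega> \<Longrightarrow> cvec (f x) = (\<Sum>k\<in>I. mode ang fhat k x)"
proof -
  assume x: "x \<in> \<Omega>"
  have "((\<lambda>k. mode ang fhat k x) has_sum (\<Sum>k\<in>I. mode ang fhat k x)) I"
    by (simp add: finite_I has_sum_finite)
  then have "((\<lambda>k. mode ang fhat k x) has_sum (\<Sum>k\<in>I. mode ang fhat k x)) UNIV"
    using has_sum_cong_neutral[of UNIV I "\<lambda>k. mode ang fhat k x" "\<lambda>k. mode ang fhat k x"] x support
    by (simp add: mode_def phase_domain_def)
  with fourier[OF x] show ?thesis by (rule has_sum_unique)
qed

text \<open>
  Since \<open>\<Omega>\<close> is convex, bounded first derivatives give a global Lipschitz constant.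
\<close>

lemma field_Lipschitz_bounded:
  obtains L M where "L > 0" "M > 0" "\<And>x y. x \<in> \<Omega> \<Longrightarrow> y \<in> \<Omega> \<Longrightarrow> norm (f x - f y) \<le> L * norm (x - y)"
    "\<And>x. x \<in> \<Omega> \<Longrightarrow> norm (f x) \<le> M"
proof -
  have "bounded_Ck UNIV \<Omega> (N - 1) (\<lambda>x. \<Sum>k\<in>I. mode ang fhat k x)"
    by (intro bounded_Ck_sum open_\<Omega> bounded_Ck_mode)
  then have "bounded_Ck UNIV \<Omega> (N - 1) (\<lambda>x. cvec (f x))"
    by (rule bounded_Ck_cong_open[OF open_\<Omega>, rotated]) (simp add: field_eq_sum_modes)
  then have *: "bounded_Ck UNIV \<Omega> (Suc 0) (\<lambda>x. cvec (f x))"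
    by (rule bounded_Ck_antimono) (use N_ge_2 in simp)
  have cv: "norm (cvec u - cvec v) = norm (u - v)" for u v :: "real ^ 'n"
    using linear_diff[OF bounded_linear.linear[OF bounded_linear_cvec], of u v] norm_cvec[of "u - v"] by simp
  obtain L where L: "L \<ge> 0" "\<And>x y. x \<in> \<Omega> \<Longrightarrow> y \<in> \<Omega> \<Longrightarrow> norm (f x - f y) \<le> L * norm (x - y)"
    using bounded_Ck_Lipschitz[OF open_\<Omega> convex_phase_domain *] unfolding cv by metis
  obtain M where M: "\<And>x. x \<in> \<Omega> \<Longrightarrow> norm (f x) \<le> M"
    using bounded_Ck_imp_continuous_bounded[OF *] by (auto simp: bounded_iff norm_cvec)
  show thesis
  proof (rule that[of "L + 1" "\<bar>M\<bar> + 1"])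
    show "norm (f x - f y) \<le> (L + 1) * norm (x - y)" if "x \<in> \<Omega>" "y \<in> \<Omega>" for x y
      using L(2)[OF that] by (simp add: algebra_simps add_increasing)
    show "norm (f x) \<le> \<bar>M\<bar> + 1" if "x \<in> \<Omega>" for x using M[OF that] by linarith
  qed (use L(1) in auto)
qed

end

section \<open>Word expansions along paths and their composition\<close>

definition words_below :: "'k set \<Rightarrow> nat \<Rightarrow> 'k list set" where
  "words_below K p = {v. set v \<subseteq> K \<and> length v < p}"

lemma finite_words_below: "finite K \<Longrightarrow> finite (words_below K p)"
  using finite_lists_length_le[of K p] by (rule finite_subset[rotated]) (auto simp: words_below_def)

lemma words_below_mono: "p \<le> q \<Longrightarrow> words_below K p \<subseteq> words_below K q"
  by (auto simp: words_below_def)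

text \<open>
  Nonempty words are split at their last letter, because the last letter carries the outermost of
  the iterated integrals.
\<close>

lemma sum_words_below_Suc:
  fixes F :: "'k list \<Rightarrow> 'a::comm_monoid_add"
  assumes "finite K"
  shows "(\<Sum>v\<in>words_below K (Suc p). F v) = F [] + (\<Sum>k\<in>K. \<Sum>v\<in>words_below K p. F (v @ [k]))"
proof -
  have "words_below K (Suc p) = insert [] ((\<lambda>(k, v). v @ [k]) ` (K \<times> words_below K p))" (is "_ = insert [] ?S")
  proof (intro equalityI subsetI)
    fix v assume "v \<in> words_below K (Suc p)"
    then show "v \<in> insert [] ?S"
      by (cases v rule: rev_cases) (auto simp: words_below_def image_iff)
  qed (auto simp: words_below_def)
  moreover have "finite ?S" using assms finite_words_below[OF assms] by simp
  moreover have "sum F ?S = (\<Sum>(k, v)\<in>K \<times> words_below K p. F (v @ [k]))"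
    by (subst sum.reindex) (auto simp: inj_on_def case_prod_unfold)
  moreover have "[] \<notin> ?S" by auto
  ultimately show ?thesis by (simp add: sum.cartesian_product)
qed

lemma smult_sum_right: "(c :: complex) *s (\<Sum>a\<in>S. g a) = (\<Sum>a\<in>S. c *s g a)"
  by (induction S rule: infinite_finite_induct) (simp_all add: vector_add_ldistrib)

text \<open>
  The abstract form of the expansion.  The functions \<open>J v\<close> are the iterated integrals of the
  \<open>\<alpha> k\<close>, characterised by their derivatives and initial values only.  The induction is on the
  remaining order \<open>N - length w\<close>: by the choice of \<open>J\<close>, the derivative of the remainder of the word
  \<open>w\<close> is the combination with coefficients \<open>\<alpha> k\<close> of the remainders of the words \<open>k # w\<close>, and the
  remainder vanishes at time 0.
\<close>

lemma word_expansion: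
  fixes \<Phi> :: "'k list \<Rightarrow> 'x \<Rightarrow> complex ^ 'n" and B C :: real
  assumes "finite K" "B \<ge> 0"
    and deriv: "\<And>w t. set w \<subseteq> K \<Longrightarrow> length w < N \<Longrightarrow> t \<in> {0..1} \<Longrightarrow>
      ((\<lambda>t. \<Phi> w (z t)) has_vector_derivative (\<Sum>k\<in>K. \<alpha> k t *s \<Phi> (k # w) (z t))) (at t within {0..1})"
    and bound: "\<And>w t. set w \<subseteq> K \<Longrightarrow> length w = N \<Longrightarrow> t \<in> {0..1} \<Longrightarrow> norm (\<Phi> w (z t)) \<le> C"
    and \<alpha>: "\<And>k t. k \<in> K \<Longrightarrow> t \<in> {0..1} \<Longrightarrow> cmod (\<alpha> k t) \<le> B"
    and J_Nil: "\<And>t. J [] t = 1" and J_0: "\<And>v k. J (v @ [k]) 0 = 0"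
    and J_deriv: "\<And>v k t. t \<in> {0..1} \<Longrightarrow>
      (J (v @ [k]) has_vector_derivative \<alpha> k t * J v t) (at t within {0..1})"
    and "set w \<subseteq> K" "length w \<le> N" "t \<in> {0..1}"
  shows "norm (\<Phi> w (z t) - (\<Sum>v\<in>words_below K (N - length w). J v t *s \<Phi> (v @ w) (z 0)))
    \<le> C * (card K * B) ^ (N - length w)"
  using assms(9-)
proof (induction "N - length w" arbitrary: w t)
  case 0
  then show ?case using bound by (simp add: words_below_def)
next
  case (Suc p)
  let ?E = "\<lambda>k t. \<Phi> (k # w) (z t) - (\<Sum>v\<in>words_below K p. J v t *s \<Phi> (v @ k # w) (z 0))"
  \<comment> \<open>The remainder of \<open>w\<close>, with the sum over words split at the last letter.\<close>
  let ?g = "\<lambda>t. \<Phi> w (z t) - (\<Phi> w (z 0) + (\<Sum>k\<in>K. \<Sum>v\<in>words_below K p. J (v @ [k]) t *s \<Phi> (v @ k # w) (z 0)))"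
  have E: "norm (?E k t) \<le> C * (card K * B) ^ p" if "k \<in> K" "t \<in> {0..1}" for k t
  proof -
    have "p = N - length (k # w)" "length (k # w) \<le> N" using Suc.hyps(2) by simp_all
    then show ?thesis using Suc.hyps(1)[of "k # w" t] Suc.prems that by simp
  qed
  have D: "(?g has_vector_derivative (\<Sum>k\<in>K. \<alpha> k t *s ?E k t)) (at t within {0..1})" if t: "t \<in> {0..1}" for t
  proof -
    have "(?g has_vector_derivative (\<Sum>k\<in>K. \<alpha> k t *s \<Phi> (k # w) (z t)) -
        (0 + (\<Sum>k\<in>K. \<Sum>v\<in>words_below K p. (\<alpha> k t * J v t) *s \<Phi> (v @ k # w) (z 0)))) (at t within {0..1})"
      using Suc t
      by (intro has_vector_derivative_diff has_vector_derivative_add has_vector_derivative_const deriv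
          has_vector_derivative_sum
          bounded_linear.has_vector_derivative[OF bounded_bilinear.bounded_linear_left[OF bounded_bilinear_complex_smult]]
          J_deriv) auto
    then show ?thesis
      by (simp add: vector_ssub_ldistrib smult_sum_right sum_subtractf vector_smult_assoc)
  qed
  have "norm (?g t - ?g 0) \<le> (\<Sum>k\<in>K. B * (C * (card K * B) ^ p)) * \<bar>t - 0\<bar>"
  proof (rule vector_derivative_bound[OF _ D])
    fix s :: real assume s: "s \<in> {0..1}"
    show "norm (\<Sum>k\<in>K. \<alpha> k s *s ?E k s) \<le> (\<Sum>k\<in>K. B * (C * (card K * B) ^ p))"
    proof (rule sum_norm_le)
      fix k assume k: "k \<in> K"
      show "norm (\<alpha> k s *s ?E k s) \<le> B * (C * (card K * B) ^ p)"
        unfolding norm_complex_smult by (rule mult_mono[OF \<alpha>[OF k s] E[OF k s] \<open>B \<ge> 0\<close> norm_ge_zero])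
    qed
  qed (use Suc in auto)
  also have "\<dots> \<le> (\<Sum>k\<in>K. B * (C * (card K * B) ^ p)) * 1"
  proof (intro mult_left_mono sum_nonneg)
    show "0 \<le> B * (C * (card K * B) ^ p)" if "k \<in> K" for k
      using order_trans[OF norm_ge_zero E[OF that, of 0]] \<open>B \<ge> 0\<close> by simp
  qed (use Suc in auto)
  also have "?g 0 = 0" by (simp add: J_0)
  finally show ?case
    by (simp add: Suc.hyps(2)[symmetric] sum_words_below_Suc[OF assms(1)] J_Nil mult_ac)
qed

text \<open>
  The product of two coefficient families that corresponds to performing first the step with
  coefficients \<open>c\<close> and then the step with coefficients \<open>c'\<close>; earlier times belong to earlier letters.
\<close>

definition split_convolution :: "('k list \<Rightarrow> complex) \<Rightarrow> ('k list \<Rightarrow> complex) \<Rightarrow> 'k list \<Rightarrow> complex" where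
  "split_convolution c c' v = (\<Sum>i\<le>length v. c (take i v) * c' (drop i v))"

lemma sum_split_convolution:
  assumes "finite K"
  shows "(\<Sum>y\<in>words_below K p. split_convolution c c' y *s F y) =
    (\<Sum>v\<in>words_below K p. \<Sum>u\<in>words_below K (p - length v). (c u * c' v) *s (F (u @ v) :: complex ^ 'n))"
proof -
  have "(\<Sum>y\<in>words_below K p. split_convolution c c' y *s F y) =
      (\<Sum>y\<in>words_below K p. \<Sum>i\<in>{..length y}. (c (take i y) * c' (drop i y)) *s F y)"
    unfolding split_convolution_def by (simp add: vec_eq_iff sum_distrib_right)
  also have "\<dots> = (\<Sum>(y, i)\<in>(SIGMA y:words_below K p. {..length y}). (c (take i y) * c' (drop i y)) *s F y)"
    by (rule sum.Sigma) (simp_all add: finite_words_below assms)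
  also have "\<dots> = (\<Sum>(v, u)\<in>(SIGMA v:words_below K p. words_below K (p - length v)). (c u * c' v) *s F (u @ v))"
    by (rule sum.reindex_bij_witness[of _ "\<lambda>(v, u). (u @ v, length u)" "\<lambda>(y, i). (drop i y, take i y)"])
      (auto simp: words_below_def dest: in_set_dropD in_set_takeD)
  also have "\<dots> = (\<Sum>v\<in>words_below K p. \<Sum>u\<in>words_below K (p - length v). (c u * c' v) *s F (u @ v))"
    by (rule sum.Sigma[symmetric]) (simp_all add: finite_words_below assms)
  finally show ?thesis .
qed

text \<open>
  The point \<open>x2\<close> is expanded around \<open>x1\<close>, and each function in that expansion is expanded around
  \<open>x0\<close>.  Multiplying \<open>\<Phi> (v @ w)\<close> by a coefficient of order \<open>\<epsilon> ^ length v\<close> makes up for the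
  \<open>length v\<close> orders by which its own expansion is shorter.
\<close>

lemma word_expansion_compose:
  fixes \<Phi> :: "'k list \<Rightarrow> 'x \<Rightarrow> complex ^ 'n" and \<epsilon> C C' D :: real
  assumes "finite K" "\<epsilon> \<ge> 0" "D \<ge> 0" "C \<ge> 0"
    and E: "\<And>w. set w \<subseteq> K \<Longrightarrow> length w \<le> N \<Longrightarrow>
      norm (\<Phi> w x1 - (\<Sum>v\<in>words_below K (N - length w). c v *s \<Phi> (v @ w) x0)) \<le> C * \<epsilon> ^ (N - length w)"
    and E': "\<And>w. set w \<subseteq> K \<Longrightarrow> length w \<le> N \<Longrightarrow>
      norm (\<Phi> w x2 - (\<Sum>v\<in>words_below K (N - length w). c' v *s \<Phi> (v @ w) x1)) \<le> C' * \<epsilon> ^ (N - length w)"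
    and c': "\<And>v. v \<in> words_below K N \<Longrightarrow> cmod (c' v) \<le> D * \<epsilon> ^ length v"
    and w: "set w \<subseteq> K" "length w \<le> N"
  shows "norm (\<Phi> w x2 - (\<Sum>v\<in>words_below K (N - length w). split_convolution c c' v *s \<Phi> (v @ w) x0))
    \<le> (C' + card (words_below K N) * (D * C)) * \<epsilon> ^ (N - length w)"
proof -
  let ?p = "N - length w"
  let ?W = "words_below K ?p"
  let ?R = "\<lambda>v. \<Phi> (v @ w) x1 - (\<Sum>u\<in>words_below K (?p - length v). c u *s \<Phi> (u @ v @ w) x0)"
  have W: "set v \<subseteq> K" "length v < ?p" "v \<in> words_below K N" if "v \<in> ?W" for v
    using that by (auto simp: words_below_def)
  have eq: "\<Phi> w x2 - (\<Sum>v\<in>?W. split_convolution c c' v *s \<Phi> (v @ w) x0) =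
      (\<Phi> w x2 - (\<Sum>v\<in>?W. c' v *s \<Phi> (v @ w) x1)) + (\<Sum>v\<in>?W. c' v *s ?R v)"
    unfolding sum_split_convolution[OF assms(1)]
    by (simp add: vector_ssub_ldistrib smult_sum_right sum_subtractf vector_smult_assoc mult.commute)
  have "norm (c' v *s ?R v) \<le> D * C * \<epsilon> ^ ?p" if v: "v \<in> ?W" for v
  proof -
    have "norm (?R v) \<le> C * \<epsilon> ^ (?p - length v)"
      using E[of "v @ w"] w W[OF v] by (simp add: add.commute)
    then have "norm (c' v *s ?R v) \<le> (D * \<epsilon> ^ length v) * (C * \<epsilon> ^ (?p - length v))"
      unfolding norm_complex_smult using c'[OF W(3)[OF v]] assms(2-4) by (intro mult_mono) auto
    also have "\<dots> = D * C * \<epsilon> ^ (length v + (?p - length v))" by (simp add: power_add mult_ac)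
    also have "length v + (?p - length v) = ?p" using W(2)[OF v] by simp
    finally show ?thesis .
  qed
  then have "norm (\<Sum>v\<in>?W. c' v *s ?R v) \<le> (\<Sum>v\<in>?W. D * C * \<epsilon> ^ ?p)" by (rule sum_norm_le)
  also have "\<dots> = card ?W * (D * C * \<epsilon> ^ ?p)" by simp
  also have "\<dots> \<le> card (words_below K N) * (D * C * \<epsilon> ^ ?p)"
    using assms(2-4) card_mono[OF finite_words_below[OF assms(1)] words_below_mono[of ?p N K]]
    by (intro mult_right_mono) auto
  finally have "norm (\<Sum>v\<in>?W. c' v *s ?R v) \<le> card (words_below K N) * (D * C * \<epsilon> ^ ?p)" .
  then have "norm ((\<Phi> w x2 - (\<Sum>v\<in>?W. c' v *s \<Phi> (v @ w) x1)) + (\<Sum>v\<in>?W. c' v *s ?R v))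
      \<le> C' * \<epsilon> ^ ?p + card (words_below K N) * (D * C * \<epsilon> ^ ?p)"
    by (rule norm_triangle_le[OF add_mono[OF E'[OF w]]])
  then show ?thesis unfolding eq by (simp only: distrib_right mult.assoc)
qed


section \<open>Coefficients of the splitting integrator\<close>

text \<open>
  The recursion of \<open>sigma\<close> removes blocks from the left, whereas a further stage of the integrator
  appends a block on the right.
\<close>

lemma sigma_append_replicate:
  "j \<notin> set js \<Longrightarrow> sigma (js @ replicate l j) = sigma js * fact l"
proof (induction js rule: sigma.induct)
  case 1
  show ?case
  proof (cases l)
    case (Suc l')
    have "takeWhile ((=) j) (replicate l' j) = replicate l' j" by (simp add: takeWhile_eq_all_conv)
    moreover have "dropWhile ((=) j) (replicate l' j) = []" by (simp add: dropWhile_eq_Nil_conv)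
    ultimately show ?thesis using Suc by simp
  qed simp
next
  case (2 i js)
  let ?P = "(=) i"
  have no: "takeWhile ?P (replicate l j) = []" "dropWhile ?P (replicate l j) = replicate l j"
    using 2(2) by (cases l; simp)+
  have "takeWhile ?P (js @ replicate l j) = takeWhile ?P js \<and>
      dropWhile ?P (js @ replicate l j) = dropWhile ?P js @ replicate l j"
  proof (cases "\<forall>x\<in>set js. i = x")
    case True
    then have all: "takeWhile ?P js = js" "dropWhile ?P js = []"
      by (simp_all add: takeWhile_eq_all_conv dropWhile_eq_Nil_conv)
    show ?thesis using True 2(2) by (auto simp: takeWhile_append dropWhile_append no all)
  qed (auto simp: takeWhile_append dropWhile_append)
  then have t: "takeWhile ?P (i # js @ replicate l j) = takeWhile ?P (i # js)"
    and d: "dropWhile ?P (i # js @ replicate l j) = dropWhile ?P (i # js) @ replicate l j"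
    by simp_all
  have "j \<notin> set (dropWhile ?P (i # js))" using 2(2) by (auto dest: set_dropWhileD)
  then show ?case
    using 2(1) by (simp only: append_Cons sigma.simps t d) simp
qed

definition phase_sum :: "(nat \<Rightarrow> real) \<Rightarrow> real ^ 'd \<Rightarrow> nat list \<Rightarrow> (int ^ 'd) list \<Rightarrow> real" where
  "phase_sum a \<omega> js w = (\<Sum>(j, k)\<leftarrow>zip js w. (\<Sum>l=1..j. a l) * kdot k \<omega>)"

lemma phase_sum_nth:
  "length js = length w \<Longrightarrow> (\<Sum>i<length w. (\<Sum>l=1..js ! i. a l) * kdot (w ! i) \<omega>) = phase_sum a \<omega> js w"
  by (simp add: phase_sum_def sum_list_sum_nth atLeast0LessThan)

lemma phase_sum_append:
  "length js = length u \<Longrightarrow> phase_sum a \<omega> (js @ js') (u @ v) = phase_sum a \<omega> js u + phase_sum a \<omega> js' v"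
  by (simp add: phase_sum_def)

lemma phase_sum_replicate:
  "length v = n \<Longrightarrow> phase_sum a \<omega> (replicate n j) v = (\<Sum>l=1..j. a l) * (\<Sum>k\<leftarrow>v. kdot k \<omega>)"
  by (induction v arbitrary: n) (auto simp: phase_sum_def algebra_simps)

text \<open>
  The coefficients of one stage, where the phase is frozen at \<open>c * h\<close>: with all times equal, the
  integral over the ordered simplex reduces to its volume \<open>1 / n!\<close>.
\<close>

definition stage_coeff :: "real \<Rightarrow> real \<Rightarrow> real ^ 'd \<Rightarrow> real \<Rightarrow> (int ^ 'd) list \<Rightarrow> complex" where
  "stage_coeff \<beta> c \<omega> h v =
     complex_of_real (\<beta> ^ length v / fact (length v)) * exp (\<i> * complex_of_real (c * (\<Sum>k\<leftarrow>v. kdot k \<omega>) * h))"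

lemma sorted_eq_takeWhile_replicate:
  "sorted js \<Longrightarrow> set js \<subseteq> {1..Suc m} \<Longrightarrow>
    js = takeWhile (\<lambda>j. j \<le> m) js @ replicate (length js - length (takeWhile (\<lambda>j. j \<le> m) js)) (Suc m)"
proof (induction js)
  case (Cons j js)
  show ?case
  proof (cases "j \<le> m")
    case True
    then show ?thesis using Cons by simp
  next
    case False
    then have "\<forall>i\<in>set (j # js). i = Suc m" using Cons.prems by force
    then have "j # js = replicate (length (j # js)) (Suc m)" by (metis replicate_eqI)
    then show ?thesis using False by simp
  qed
qed simp

text \<open>
  A nondecreasing list of indices up to \<open>m + 1\<close> consists of a nondecreasing list of indices up to
  \<open>m\<close> and a final block of \<open>m + 1\<close>; the length of the first part is the place where the word is cut.
\<close>

lemma split_coeff_Suc: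
  "split_coeff (Suc m) a b \<omega> w h =
    split_convolution (\<lambda>u. split_coeff m a b \<omega> u h) (stage_coeff (b (Suc m)) (\<Sum>l=1..Suc m. a l) \<omega> h) w"
proof -
  let ?J = "\<lambda>m n. {js :: nat list. length js = n \<and> sorted js \<and> set js \<subseteq> {1..m}}"
  let ?T = "\<lambda>w js. complex_of_real (prod_list (map b js) / real (sigma js)) * exp (\<i> * complex_of_real (phase_sum a \<omega> js w * h))"
  let ?n = "length w"
  have fin: "finite (?J m n)" for m n
    by (rule finite_subset[OF _ finite_lists_length_eq[OF finite_atLeastAtMost, of 1 m n]]) auto
  have S: "split_coeff m a b \<omega> w h = (\<Sum>js\<in>?J m (length w). ?T w js)" for m w
    unfolding split_coeff_def
  proof (rule sum.cong[OF refl])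
    fix js assume "js \<in> ?J m (length w)"
    then have "length js = length w" by simp
    note eq = phase_sum_nth[OF this, of a \<omega>]
    show "complex_of_real (prod_list (map b js) / real (sigma js)) *
        exp (\<i> * complex_of_real ((\<Sum>i<length w. (\<Sum>l=1..js ! i. a l) * kdot (w ! i) \<omega>) * h)) = ?T w js"
      by (simp only: eq)
  qed
  have summand: "?T w (js @ replicate (?n - i) (Suc m)) =
      ?T (take i w) js * stage_coeff (b (Suc m)) (\<Sum>l=1..Suc m. a l) \<omega> h (drop i w)"
    if "i \<le> ?n" "js \<in> ?J m i" for i js
  proof -
    have "Suc m \<notin> set js" using that(2) by auto
    moreover have "phase_sum a \<omega> (js @ replicate (?n - i) (Suc m)) w =
        phase_sum a \<omega> js (take i w) + (\<Sum>l=1..Suc m. a l) * (\<Sum>k\<leftarrow>drop i w. kdot k \<omega>)"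
      using phase_sum_append[of js "take i w" a \<omega> "replicate (?n - i) (Suc m)" "drop i w"] that
      by (simp add: phase_sum_replicate del: sum.cl_ivl_Suc)
    ultimately show ?thesis
      by (simp add: sigma_append_replicate stage_coeff_def exp_add algebra_simps prod_list_replicate del: sum.cl_ivl_Suc)
  qed
  have "split_coeff (Suc m) a b \<omega> w h = (\<Sum>js\<in>?J (Suc m) ?n. ?T w js)" by (rule S)
  also have "\<dots> = (\<Sum>(i, js)\<in>(SIGMA i:{..?n}. ?J m i). ?T w (js @ replicate (?n - i) (Suc m)))"
  proof (rule sum.reindex_bij_witness[of _ "\<lambda>(i, js). js @ replicate (?n - i) (Suc m)"
        "\<lambda>js. (length (takeWhile (\<lambda>j. j \<le> m) js), takeWhile (\<lambda>j. j \<le> m) js)"])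
    fix js assume js: "js \<in> ?J (Suc m) ?n"
    have dec: "takeWhile (\<lambda>j. j \<le> m) js @ replicate (?n - length (takeWhile (\<lambda>j. j \<le> m) js)) (Suc m) = js"
      using sorted_eq_takeWhile_replicate[of js m] js by simp
    show "(case (length (takeWhile (\<lambda>j. j \<le> m) js), takeWhile (\<lambda>j. j \<le> m) js) of
        (i, js) \<Rightarrow> js @ replicate (?n - i) (Suc m)) = js"
      by (simp only: prod.case dec)
    show "(length (takeWhile (\<lambda>j. j \<le> m) js), takeWhile (\<lambda>j. j \<le> m) js) \<in> (SIGMA i:{..?n}. ?J m i)"
      using js length_takeWhile_le[of "\<lambda>j. j \<le> m" js] by (fastforce simp: sorted_takeWhile dest: set_takeWhileD)
    show "(case (length (takeWhile (\<lambda>j. j \<le> m) js), takeWhile (\<lambda>j. j \<le> m) js) of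
        (i, js) \<Rightarrow> ?T w (js @ replicate (?n - i) (Suc m))) = ?T w js"
      by (simp only: prod.case dec)
  next
    fix p assume "p \<in> (SIGMA i:{..?n}. ?J m i)"
    then obtain i js where p: "p = (i, js)" "i \<le> ?n" "js \<in> ?J m i" by auto
    have "takeWhile (\<lambda>j. j \<le> m) (js @ replicate (?n - i) (Suc m)) = js"
      using p(3) by (subst takeWhile_append2) (auto simp: takeWhile_replicate)
    then show "(length (takeWhile (\<lambda>j. j \<le> m) (case p of (i, js) \<Rightarrow> js @ replicate (?n - i) (Suc m))),
        takeWhile (\<lambda>j. j \<le> m) (case p of (i, js) \<Rightarrow> js @ replicate (?n - i) (Suc m))) = p"
      using p by simp
    show "(case p of (i, js) \<Rightarrow> js @ replicate (?n - i) (Suc m)) \<in> ?J (Suc m) ?n"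
      using p by (fastforce simp: sorted_append)
  qed
  also have "\<dots> = (\<Sum>(i, js)\<in>(SIGMA i:{..?n}. ?J m i).
      ?T (take i w) js * stage_coeff (b (Suc m)) (\<Sum>l=1..Suc m. a l) \<omega> h (drop i w))"
  proof (rule sum.cong[OF refl])
    fix p assume "p \<in> (SIGMA i:{..?n}. ?J m i)"
    then obtain i js where p: "p = (i, js)" "i \<le> ?n" "js \<in> ?J m i" by auto
    show "(case p of (i, js) \<Rightarrow> ?T w (js @ replicate (?n - i) (Suc m))) = (case p of (i, js) \<Rightarrow>
        ?T (take i w) js * stage_coeff (b (Suc m)) (\<Sum>l=1..Suc m. a l) \<omega> h (drop i w))"
      unfolding p(1) prod.case by (rule summand[OF p(2,3)])
  qed
  also have "\<dots> = (\<Sum>i\<le>?n. \<Sum>js\<in>?J m i.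
      ?T (take i w) js * stage_coeff (b (Suc m)) (\<Sum>l=1..Suc m. a l) \<omega> h (drop i w))"
    by (rule sum.Sigma[symmetric]) (use fin in auto)
  also have "\<dots> = (\<Sum>i\<le>?n. split_coeff m a b \<omega> (take i w) h * stage_coeff (b (Suc m)) (\<Sum>l=1..Suc m. a l) \<omega> h (drop i w))"
    by (intro sum.cong refl) (simp add: S sum_distrib_right min_def del: sum.cl_ivl_Suc)
  finally show ?thesis unfolding split_convolution_def .
qed

lemma split_coeff_0: "split_coeff 0 a b \<omega> w h = (if w = [] then 1 else 0)"
proof -
  have "{js. length js = length w \<and> sorted js \<and> set js \<subseteq> {1..0}} = (if w = [] then {[]} else ({} :: nat list set))"
    by auto
  then show ?thesis by (simp add: split_coeff_def)
qed

section \<open>Coefficients of the exact solution\<close>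

text \<open>
  The simplex with a variable upper bound \<open>T\<close> in place of 1.  The bound has to vary because fixing
  the last coordinate of a simplex leaves a smaller simplex bounded by that coordinate.
\<close>

definition scaled_simplex :: "nat \<Rightarrow> real \<Rightarrow> (nat \<Rightarrow> real) set" where
  "scaled_simplex n T = {t. (\<forall>i<n. 0 \<le> t i \<and> t i \<le> T) \<and> (\<forall>i j. i \<le> j \<and> j < n \<longrightarrow> t i \<le> t j)}"

definition simplex_integral :: "real list \<Rightarrow> real \<Rightarrow> complex" where
  "simplex_integral bs T =
     (LINT t|Pi\<^sub>M {..<length bs} (\<lambda>_. lborel). indicator (scaled_simplex (length bs) T) t *\<^sub>R
        exp (\<i> * complex_of_real (\<Sum>i<length bs. t i * bs ! i)))"

text \<open>
  The list is in reversed order: its head belongs to the last letter of a word, that is, to the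
  outermost integral.
\<close>

primrec iterated_integral :: "real list \<Rightarrow> real \<Rightarrow> complex" where
  "iterated_integral [] T = 1"
| "iterated_integral (\<beta> # bs) T =
     integral {0..T} (\<lambda>s. exp (\<i> * complex_of_real (s * \<beta>)) * iterated_integral bs s)"

lemma continuous_on_iterated_integral: "continuous_on {0..c} (iterated_integral bs)"
proof (induction bs)
  case (Cons \<beta> bs)
  have "continuous_on {0..c} (\<lambda>s. exp (\<i> * complex_of_real (s * \<beta>)) * iterated_integral bs s)"
    by (intro continuous_intros Cons)
  then have "(\<lambda>s. exp (\<i> * complex_of_real (s * \<beta>)) * iterated_integral bs s) integrable_on {0..c}"
    by (rule integrable_continuous_real)
  from indefinite_integral_continuous_1[OF this] show ?case by simp
qed simp

lemma iterated_integral_has_vector_derivative: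
  assumes "t \<in> {0..c}"
  shows "(iterated_integral (\<beta> # bs) has_vector_derivative
    exp (\<i> * complex_of_real (t * \<beta>)) * iterated_integral bs t) (at t within {0..c})"
proof -
  have "continuous_on {0..c} (\<lambda>s. exp (\<i> * complex_of_real (s * \<beta>)) * iterated_integral bs s)"
    by (intro continuous_intros continuous_on_iterated_integral)
  moreover have "iterated_integral (\<beta> # bs) =
      (\<lambda>T. integral {0..T} (\<lambda>s. exp (\<i> * complex_of_real (s * \<beta>)) * iterated_integral bs s))"
    by (rule ext) simp
  ultimately show ?thesis using integral_has_vector_derivative[OF _ assms] by (simp only:)
qed

interpretation lborel_nat: product_sigma_finite "\<lambda>_::nat. lborel :: real measure" ..

lemma scaled_simplex_sets:
  "scaled_simplex n T \<inter> space (Pi\<^sub>M {..<n} (\<lambda>_. lborel)) \<in> sets (Pi\<^sub>M {..<n} (\<lambda>_. lborel :: real measure))"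
proof -
  let ?M = "Pi\<^sub>M {..<n} (\<lambda>_. lborel :: real measure)"
  have "scaled_simplex n T \<inter> space ?M = {t \<in> space ?M. (\<forall>i\<in>{..<n}. 0 \<le> t i \<and> t i \<le> T) \<and>
      (\<forall>i\<in>{..<n}. \<forall>j\<in>{..<n}. i \<le> j \<longrightarrow> t i \<le> t j)}"
    by (auto simp: scaled_simplex_def)
  also have "\<dots> \<in> sets ?M"
  proof (intro sets.sets_Collect_conj sets.sets_Collect_finite_All finite_lessThan)
    have comp: "(\<lambda>t. t i) \<in> borel_measurable ?M" if "i \<in> {..<n}" for i
      using measurable_component_singleton[OF that, of "\<lambda>_. lborel :: real measure"] by simp
    fix i assume i: "i \<in> {..<n}"
    show "{t \<in> space ?M. 0 \<le> t i} \<in> sets ?M" "{t \<in> space ?M. t i \<le> T} \<in> sets ?M"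
      using comp[OF i] by (auto intro: borel_measurable_le)
    fix j assume j: "j \<in> {..<n}"
    show "{t \<in> space ?M. i \<le> j \<longrightarrow> t i \<le> t j} \<in> sets ?M"
      using borel_measurable_le[OF comp[OF i] comp[OF j]] by (cases "i \<le> j") simp_all
  qed
  finally show ?thesis .
qed

lemma simplex_integrand_measurable:
  "(\<lambda>t. indicator (scaled_simplex (length bs) T) t *\<^sub>R exp (\<i> * complex_of_real (\<Sum>i<length bs. t i * bs ! i)))
     \<in> borel_measurable (Pi\<^sub>M {..<length bs} (\<lambda>_. lborel))"
proof -
  have [measurable]: "(indicator (scaled_simplex (length bs) T) :: _ \<Rightarrow> real)
      \<in> borel_measurable (Pi\<^sub>M {..<length bs} (\<lambda>_. lborel))"
    using scaled_simplex_sets by (simp add: borel_measurable_indicator_iff)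
  show ?thesis by measurable
qed

lemma simplex_integrand_integrable:
  "integrable (Pi\<^sub>M {..<length bs} (\<lambda>_. lborel))
    (\<lambda>t. indicator (scaled_simplex (length bs) T) t *\<^sub>R exp (\<i> * complex_of_real (\<Sum>i<length bs. t i * bs ! i)))"
proof (rule integrableI_bounded_set[where A = "PiE {..<length bs} (\<lambda>_. {0..T})" and B = 1])
  let ?M = "Pi\<^sub>M {..<length bs} (\<lambda>_. lborel :: real measure)"
  show "PiE {..<length bs} (\<lambda>_. {0..T}) \<in> sets ?M" by (rule sets_PiM_I_finite) auto
  have "emeasure ?M (PiE {..<length bs} (\<lambda>_. {0..T})) = (\<Prod>i<length bs. emeasure lborel {0..T})"
    by (rule lborel_nat.emeasure_PiM) auto
  also have "\<dots> < \<infinity>" by (cases "0 \<le> T") (simp_all add: ennreal_power[symmetric] power_less_top_ennreal)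
  finally show "emeasure ?M (PiE {..<length bs} (\<lambda>_. {0..T})) < \<infinity>" .
  show "AE t in ?M. t \<in> PiE {..<length bs} (\<lambda>_. {0..T}) \<longrightarrow>
      norm (indicator (scaled_simplex (length bs) T) t *\<^sub>R exp (\<i> * complex_of_real (\<Sum>i<length bs. t i * bs ! i))) \<le> 1"
    by (auto simp: indicator_def)
  show "AE t in ?M. t \<notin> PiE {..<length bs} (\<lambda>_. {0..T}) \<longrightarrow>
      indicator (scaled_simplex (length bs) T) t *\<^sub>R exp (\<i> * complex_of_real (\<Sum>i<length bs. t i * bs ! i)) = 0"
    by (rule AE_I2) (auto simp: indicator_def scaled_simplex_def space_PiM PiE_iff)
qed (rule simplex_integrand_measurable)

lemma simplex_integral_Nil: "simplex_integral [] T = 1"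
  by (simp add: simplex_integral_def scaled_simplex_def PiM_empty lebesgue_integral_count_space_finite)

lemma merge_in_scaled_simplex:
  "merge {n} {..<n} (x, y) \<in> scaled_simplex (Suc n) T \<longleftrightarrow> x n \<in> {0..T} \<and> y \<in> scaled_simplex n (x n)"
proof -
  have m: "merge {n} {..<n} (x, y) n = x n" "\<And>i. i < n \<Longrightarrow> merge {n} {..<n} (x, y) i = y i"
    by (auto simp: merge_def)
  show ?thesis
  proof
    assume "merge {n} {..<n} (x, y) \<in> scaled_simplex (Suc n) T"
    then have *: "\<And>i. i < Suc n \<Longrightarrow> 0 \<le> merge {n} {..<n} (x, y) i \<and> merge {n} {..<n} (x, y) i \<le> T"
      "\<And>i j. i \<le> j \<Longrightarrow> j < Suc n \<Longrightarrow> merge {n} {..<n} (x, y) i \<le> merge {n} {..<n} (x, y) j"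
      by (auto simp: scaled_simplex_def)
    have "0 \<le> y i \<and> y i \<le> x n" if "i < n" for i
      using *(1)[of i] *(2)[of i n] that by (simp add: m)
    moreover have "y i \<le> y j" if "i \<le> j" "j < n" for i j
      using *(2)[of i j] that by (simp add: m)
    ultimately show "x n \<in> {0..T} \<and> y \<in> scaled_simplex n (x n)"
      using *(1)[of n] by (simp add: m scaled_simplex_def)
  next
    assume *: "x n \<in> {0..T} \<and> y \<in> scaled_simplex n (x n)"
    have "0 \<le> merge {n} {..<n} (x, y) i \<and> merge {n} {..<n} (x, y) i \<le> T" if "i < Suc n" for i
      using * that by (cases "i = n") (auto simp: m scaled_simplex_def less_Suc_eq intro: order_trans)
    moreover have "merge {n} {..<n} (x, y) i \<le> merge {n} {..<n} (x, y) j" if "i \<le> j" "j < Suc n" for i j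
      using * that by (cases "j = n"; cases "i = n") (auto simp: m scaled_simplex_def less_Suc_eq)
    ultimately show "merge {n} {..<n} (x, y) \<in> scaled_simplex (Suc n) T"
      by (auto simp: scaled_simplex_def)
  qed
qed

text \<open>
  Fubini's theorem with the last and largest coordinate integrated last.
\<close>

lemma simplex_integral_append:
  assumes "0 \<le> T"
    and IH: "\<And>s. s \<in> {0..T} \<Longrightarrow> simplex_integral bs s = iterated_integral rbs s"
  shows "simplex_integral (bs @ [\<beta>]) T = iterated_integral (\<beta> # rbs) T"
proof -
  let ?n = "length bs"
  let ?g = "\<lambda>s. exp (\<i> * complex_of_real (s * \<beta>)) * iterated_integral rbs s"
  let ?F = "\<lambda>t. indicator (scaled_simplex (Suc ?n) T) t *\<^sub>R
        exp (\<i> * complex_of_real (\<Sum>i<Suc ?n. t i * (bs @ [\<beta>]) ! i))"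
  have g: "continuous_on {0..T} ?g" by (intro continuous_intros continuous_on_iterated_integral)
  have Un: "{..<Suc ?n} = {?n} \<union> {..<?n}" by auto
  have inner: "(LINT y|Pi\<^sub>M {..<?n} (\<lambda>_. lborel). ?F (merge {?n} {..<?n} (x, y))) = indicator {0..T} (x ?n) *\<^sub>R ?g (x ?n)" for x
  proof -
    have "?F (merge {?n} {..<?n} (x, y)) = (indicator {0..T} (x ?n) *\<^sub>R exp (\<i> * complex_of_real (x ?n * \<beta>))) *
        (indicator (scaled_simplex ?n (x ?n)) y *\<^sub>R exp (\<i> * complex_of_real (\<Sum>i<?n. y i * bs ! i)))" for y
    proof -
      have "(\<Sum>i<Suc ?n. merge {?n} {..<?n} (x, y) i * (bs @ [\<beta>]) ! i) = x ?n * \<beta> + (\<Sum>i<?n. y i * bs ! i)"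
        by (simp add: merge_def nth_append)
      then show ?thesis
        using merge_in_scaled_simplex[of ?n x y T]
        by (auto simp: indicator_def exp_add distrib_left)
    qed
    then have "(LINT y|Pi\<^sub>M {..<?n} (\<lambda>_. lborel). ?F (merge {?n} {..<?n} (x, y))) =
        (indicator {0..T} (x ?n) *\<^sub>R exp (\<i> * complex_of_real (x ?n * \<beta>))) * simplex_integral bs (x ?n)"
      by (simp only: simplex_integral_def integral_mult_right_zero)
    then show ?thesis using IH[of "x ?n"] by (cases "x ?n \<in> {0..T}") auto
  qed
  have "simplex_integral (bs @ [\<beta>]) T = integral\<^sup>L (Pi\<^sub>M ({?n} \<union> {..<?n}) (\<lambda>_. lborel)) ?F"
    by (simp only: simplex_integral_def Un[symmetric] length_append_singleton)
  also have "\<dots> = (LINT x|Pi\<^sub>M {?n} (\<lambda>_. lborel). LINT y|Pi\<^sub>M {..<?n} (\<lambda>_. lborel). ?F (merge {?n} {..<?n} (x, y)))"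
    using simplex_integrand_integrable[of "bs @ [\<beta>]" T]
    by (intro lborel_nat.product_integral_fold) (simp_all only: Un[symmetric] length_append_singleton, auto)
  also have "\<dots> = (LINT x|Pi\<^sub>M {?n} (\<lambda>_. lborel). indicator {0..T} (x ?n) *\<^sub>R ?g (x ?n))"
    by (simp only: inner)
  also have "\<dots> = (LINT s|lborel. indicator {0..T} s *\<^sub>R ?g s)"
    using borel_measurable_continuous_on_indicator[OF _ g]
    by (intro lborel_nat.product_integral_singleton[of "\<lambda>s. indicator {0..T} s *\<^sub>R ?g s" ?n]) simp
  also have "\<dots> = integral {0..T} ?g"
    using set_borel_integral_eq_integral(2)[OF borel_integrable_atLeastAtMost'[OF g]]
    by (simp add: set_lebesgue_integral_def)
  finally show ?thesis by simp
qed

lemma simplex_integral_eq_iterated: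
  "0 \<le> T \<Longrightarrow> simplex_integral bs T = iterated_integral (rev bs) T"
proof (induction bs arbitrary: T rule: rev_induct)
  case Nil
  then show ?case by (simp add: simplex_integral_Nil)
next
  case (snoc \<beta> bs)
  then show ?case using simplex_integral_append[of T bs "rev bs" \<beta>] by simp
qed

lemma exact_coeff_eq_iterated:
  "exact_coeff \<omega> w h = iterated_integral (rev (map (\<lambda>k. kdot k \<omega> * h) w)) 1"
proof -
  have "exact_coeff \<omega> w h = simplex_integral (map (\<lambda>k. kdot k \<omega> * h) w) 1"
    by (simp add: exact_coeff_def simplex_integral_def set_lebesgue_integral_def ordered_simplex_def
        scaled_simplex_def sum_distrib_right mult.assoc)
  then show ?thesis by (simp add: simplex_integral_eq_iterated)
qed

section \<open>Autonomous initial value problems and flows\<close>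

text \<open>
  The Picard iteration on bounded continuous functions.  Time is scaled to the unit interval, so that
  a short time becomes a small Lipschitz constant \<open>c\<close> and a single contraction suffices.  Functions
  are defined on the whole line by freezing the time outside \<open>[0,1]\<close>.
\<close>

lemma autonomous_ivp_solution_exists:
  fixes G :: "'a::euclidean_space \<Rightarrow> 'a"
  assumes "0 \<le> c" "c < 1" and Lip: "\<And>x y. norm (G x - G y) \<le> c * norm (x - y)"
  obtains X where "X 0 = x0" "\<And>s. s \<in> {0..1::real} \<Longrightarrow> (X has_vector_derivative G (X s)) (at s within {0..1})"
proof -
  have contG: "continuous_on S G" for S
  proof (rule continuous_on_subset[OF lipschitz_on_continuous_on[of c UNIV G] subset_UNIV])
    show "c-lipschitz_on UNIV G" using assms(1) Lip by (simp add: lipschitz_on_def dist_norm)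
  qed
  let ?P = "\<lambda>(\<phi> :: real \<Rightarrow>\<^sub>C 'a) t. x0 + integral {0..t} (\<lambda>s. G (apply_bcontfun \<phi> s))"
  let ?cl = "\<lambda>t :: real. max 0 (min 1 t)"
  have contGi: "continuous_on S (\<lambda>s. G (apply_bcontfun \<phi> s))" for \<phi> :: "real \<Rightarrow>\<^sub>C 'a" and S
    by (rule continuous_on_compose2[OF contG[of UNIV]]) auto
  have contP: "continuous_on {0..1} (?P \<phi>)" for \<phi>
    using indefinite_integral_continuous_1[OF integrable_continuous_real[OF contGi]]
    by (intro continuous_intros)
  have mem: "(\<lambda>t. ?P \<phi> (?cl t)) \<in> bcontfun" for \<phi>
  proof -
    have "continuous_on UNIV (\<lambda>t. ?P \<phi> (?cl t))"
      by (rule continuous_on_compose2[OF contP[of \<phi>]]) (auto intro!: continuous_intros)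
    moreover have "range (\<lambda>t. ?P \<phi> (?cl t)) \<subseteq> ?P \<phi> ` {0..1}" by auto
    then have "bounded (range (\<lambda>t. ?P \<phi> (?cl t)))"
      by (rule bounded_subset[OF compact_imp_bounded[OF compact_continuous_image[OF contP compact_Icc]]])
    ultimately show ?thesis by (simp add: bcontfun_def)
  qed
  define T where "T \<phi> = Bcontfun (\<lambda>t. ?P \<phi> (?cl t))" for \<phi>
  have T: "apply_bcontfun (T \<phi>) t = ?P \<phi> (?cl t)" for \<phi> t
    unfolding T_def using Bcontfun_inverse[OF mem[of \<phi>]] by simp
  have "dist (T \<phi>) (T \<psi>) \<le> c * dist \<phi> \<psi>" for \<phi> \<psi>
  proof (rule dist_bound)
    fix t
    let ?s = "?cl t"
    have "norm (integral {0..?s} (\<lambda>s. G (apply_bcontfun \<phi> s) - G (apply_bcontfun \<psi> s))) \<le> c * dist \<phi> \<psi> * (?s - 0)"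
    proof (rule integral_bound)
      show "continuous_on {0..?s} (\<lambda>s. G (apply_bcontfun \<phi> s) - G (apply_bcontfun \<psi> s))"
        by (intro continuous_intros contGi)
      show "norm (G (apply_bcontfun \<phi> s) - G (apply_bcontfun \<psi> s)) \<le> c * dist \<phi> \<psi>" for s
        using Lip[of "apply_bcontfun \<phi> s" "apply_bcontfun \<psi> s"] dist_bounded[of \<phi> s \<psi>] assms(1)
        by (metis dist_norm mult_left_mono order_trans)
    qed simp
    also have "\<dots> \<le> c * dist \<phi> \<psi> * 1"
      using assms(1) by (intro mult_left_mono) auto
    finally show "dist (apply_bcontfun (T \<phi>) t) (apply_bcontfun (T \<psi>) t) \<le> c * dist \<phi> \<psi>"
      unfolding T by (simp add: dist_norm integral_diff[OF integrable_continuous_real[OF contGi] integrable_continuous_real[OF contGi]])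
  qed
  then obtain \<phi> where "T \<phi> = \<phi>" using banach_fix_type[OF assms(1,2), of T] by blast
  then have fix_eq: "apply_bcontfun \<phi> t = ?P \<phi> t" if "t \<in> {0..1}" for t
    using T[of \<phi> t] that by simp
  show thesis
  proof (rule that[of "apply_bcontfun \<phi>"])
    show "apply_bcontfun \<phi> 0 = x0" using fix_eq[of 0] by simp
    fix s :: real assume s: "s \<in> {0..1}"
    have "(?P \<phi> has_vector_derivative 0 + G (apply_bcontfun \<phi> s)) (at s within {0..1})"
      by (intro has_vector_derivative_add has_vector_derivative_const integral_has_vector_derivative contGi s)
    then show "(apply_bcontfun \<phi> has_vector_derivative G (apply_bcontfun \<phi> s)) (at s within {0..1})"
      using has_vector_derivative_transform[OF s fix_eq] by simp
  qed
qed

text \<open>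
  If \<open>\<delta>\<close> is the largest distance of the two solutions, the mean value inequality gives \<open>\<delta> \<le> c * \<delta>\<close>.
\<close>

lemma autonomous_ivp_solution_unique:
  fixes X Y :: "real \<Rightarrow> 'a::real_normed_vector"
  assumes "0 \<le> c" "c < 1"
    and Lip: "\<And>x y. x \<in> S \<Longrightarrow> y \<in> S \<Longrightarrow> norm (G x - G y) \<le> c * norm (x - y)"
    and X: "\<And>s. s \<in> {0..1} \<Longrightarrow> X s \<in> S \<and> (X has_vector_derivative G (X s)) (at s within {0..1})"
    and Y: "\<And>s. s \<in> {0..1} \<Longrightarrow> Y s \<in> S \<and> (Y has_vector_derivative G (Y s)) (at s within {0..1})"
    and "X 0 = Y 0" "s \<in> {0..1}"
  shows "X s = Y s"
proof -
  have "continuous_on {0..1} (\<lambda>s. norm (X s - Y s))"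
    unfolding continuous_on_eq_continuous_within
    by (intro ballI continuous_intros) (use X Y has_vector_derivative_continuous in blast)+
  then obtain m where m: "m \<in> {0..1}" "\<And>s. s \<in> {0..1} \<Longrightarrow> norm (X s - Y s) \<le> norm (X m - Y m)"
    using continuous_attains_sup[of "{0..1::real}" "\<lambda>s. norm (X s - Y s)"] by auto
  have "norm ((X m - Y m) - (X 0 - Y 0)) \<le> (c * norm (X m - Y m)) * \<bar>m - 0\<bar>"
  proof (rule vector_derivative_bound[where S = "{0..1}"])
    fix t :: real assume t: "t \<in> {0..1}"
    show "((\<lambda>t. X t - Y t) has_vector_derivative G (X t) - G (Y t)) (at t within {0..1})"
      using X[OF t] Y[OF t] by (intro has_vector_derivative_diff) auto
    have "norm (G (X t) - G (Y t)) \<le> c * norm (X t - Y t)" using X[OF t] Y[OF t] Lip by blast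
    also have "\<dots> \<le> c * norm (X m - Y m)" using m(2)[OF t] assms(1) by (rule mult_left_mono)
    finally show "norm (G (X t) - G (Y t)) \<le> c * norm (X m - Y m)" .
  qed (use m in auto)
  also have "\<dots> \<le> (c * norm (X m - Y m)) * 1"
    using m(1) assms(1) by (intro mult_left_mono) auto
  finally have "(1 - c) * norm (X m - Y m) \<le> 0" using assms(6) by (simp add: algebra_simps)
  then have "norm (X m - Y m) \<le> 0" using assms(2) by (simp add: mult_le_0_iff)
  then show ?thesis using m(2)[OF assms(7)] by simp
qed

lemma closed_segment_0_eq_image: "closed_segment 0 (h::real) = (\<lambda>s. h * s) ` {0..1}"
  by (auto simp: closed_segment_def mult.commute)

text \<open>
  A solution \<open>Z\<close> on the unit interval of the equation multiplied by \<open>h\<close> computes the \<open>h\<close>-flow,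
  whatever the sign of \<open>h\<close>.  Every solution \<open>Y\<close> of the original problem satisfies \<open>Y (h * s) = Z s\<close>,
  which proves uniqueness and identifies the value at time \<open>h\<close>, also for \<open>h = 0\<close>.
\<close>

lemma flow_eq_Some:
  fixes F :: "'a::real_normed_vector \<Rightarrow> 'a"
  assumes Lip: "\<And>x y. x \<in> S \<Longrightarrow> y \<in> S \<Longrightarrow> norm (F x - F y) \<le> L * norm (x - y)"
    and "0 \<le> L" "\<bar>h\<bar> * L < 1" and "Z 0 = x0"
    and Z: "\<And>s. s \<in> {0..1} \<Longrightarrow> Z s \<in> S \<and> (Z has_vector_derivative h *\<^sub>R F (Z s)) (at s within {0..1})"
  shows "flow F S h x0 = Some (Z 1)"
proof -
  have LipG: "norm (h *\<^sub>R F x - h *\<^sub>R F y) \<le> \<bar>h\<bar> * L * norm (x - y)" if "x \<in> S" "y \<in> S" for x y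
    using mult_left_mono[OF Lip[OF that], of "\<bar>h\<bar>"]
    by (simp add: scaleR_diff_right[symmetric] mult.assoc)
  have unique: "Y (h * s) = Z s" if Y: "solves_ivp F S x0 h Y" and s: "s \<in> {0..1}" for Y s
  proof (rule autonomous_ivp_solution_unique[where X = "\<lambda>s. Y (h * s)" and Y = Z and c = "\<bar>h\<bar> * L", OF _ _ LipG _ Z])
    fix t :: real assume t: "t \<in> {0..1}"
    then have "h * t \<in> closed_segment 0 h" by (auto simp: closed_segment_0_eq_image)
    then have Yt: "Y (h * t) \<in> S"
        "(Y has_vector_derivative F (Y (h * t))) (at (h * t) within (\<lambda>s. h * s) ` {0..1})"
      using Y by (auto simp: solves_ivp_def closed_segment_0_eq_image)
    have "(Y \<circ> (\<lambda>s. h * s) has_vector_derivative h *\<^sub>R F (Y (h * t))) (at t within {0..1})"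
      by (rule vector_diff_chain_within[OF _ Yt(2)]) (auto intro!: derivative_eq_intros)
    then show "Y (h * t) \<in> S \<and> ((\<lambda>s. Y (h * s)) has_vector_derivative h *\<^sub>R F (Y (h * t))) (at t within {0..1})"
      using Yt(1) by (simp add: o_def)
  qed (use assms s Y in \<open>auto simp: solves_ivp_def\<close>)
  have sol: "solves_ivp F S x0 h (\<lambda>t. Z (t / h))"
    unfolding solves_ivp_def
  proof (intro conjI ballI)
    fix t assume t: "t \<in> closed_segment 0 h"
    then have th: "t / h \<in> {0..1}" by (auto simp: closed_segment_0_eq_image)
    then show "Z (t / h) \<in> S" using Z by blast
    show "((\<lambda>t. Z (t / h)) has_vector_derivative F (Z (t / h))) (at t within closed_segment 0 h)"
    proof (cases "h = 0")
      case True
      have "at (0::real) within {0} = bot" by (simp add: at_within_eq_bot_iff)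
      with True t show ?thesis
        by (auto simp: has_vector_derivative_def intro!: has_derivative_bot bounded_linear_scaleR_left)
    next
      case False
      have img: "(\<lambda>t. t / h) ` closed_segment 0 h \<subseteq> {0..1}" by (auto simp: closed_segment_0_eq_image)
      have "(Z \<circ> (\<lambda>t. t / h) has_vector_derivative (1 / h) *\<^sub>R (h *\<^sub>R F (Z (t / h)))) (at t within closed_segment 0 h)"
        using False has_vector_derivative_within_subset[OF conjunct2[OF Z[OF th]] img]
        by (intro vector_diff_chain_within) (auto intro!: derivative_eq_intros)
      then show ?thesis using False by (simp add: o_def)
    qed
  qed (simp add: assms)
  have ex: "\<exists>X. solves_ivp F S x0 h X \<and>
      (\<forall>Y. solves_ivp F S x0 h Y \<longrightarrow> (\<forall>s \<in> closed_segment 0 h. Y s = X s))"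
    using sol unique by (intro exI[of _ "\<lambda>t. Z (t / h)"]) (auto simp: closed_segment_0_eq_image)
  have "(SOME X. solves_ivp F S x0 h X) h = Z 1"
    using unique[OF someI[of "solves_ivp F S x0 h", OF sol], of 1] by simp
  then show ?thesis unfolding flow_def using ex by simp
qed


section \<open>Flows in the phase domain\<close>

lemma norm_ypart_le: "norm (ypart ang x) \<le> norm x"
  by (rule norm_le_componentwise_cart) (simp add: ypart_def)

lemma ypart_state_0: "ypart ang (state ang 0 \<omega>) = 0"
  by (simp add: ypart_def state_def vec_eq_iff)

lemma state_0_scaleR: "state ang 0 (c *\<^sub>R \<omega>) = c *\<^sub>R state ang 0 \<omega>"
  by (simp add: state_def vec_eq_iff)

lemma kdot_scaleR: "kdot k (c *\<^sub>R \<omega>) = c * kdot k \<omega>"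
  by (simp add: kdot_def sum_distrib_left mult_ac)

lemma ypart_add: "ypart ang (x + y) = ypart ang x + ypart ang y"
  by (simp add: ypart_def vec_eq_iff)

lemma ypart_scaleR: "ypart ang (c *\<^sub>R x) = c *\<^sub>R ypart ang x"
  by (simp add: ypart_def vec_eq_iff)

context oscillatory_field
begin

text \<open>
  The Lipschitz field exists only on \<open>\<Omega>\<close>; precomposing it with the projection onto the closed convex
  set \<open>K\<close> of points with \<open>y\<close> in a smaller ball makes it globally Lipschitz with the same constant.
  The drift \<open>u\<close> does not move \<open>y\<close>, so the solution stays in \<open>K\<close>, where the projection has no effect.
\<close>

lemma perturbed_path_exists:
  assumes Lip: "\<And>x y. x \<in> \<Omega> \<Longrightarrow> y \<in> \<Omega> \<Longrightarrow> norm (f x - f y) \<le> L * norm (x - y)" and "0 \<le> L"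
    and M: "\<And>x. x \<in> \<Omega> \<Longrightarrow> norm (f x) \<le> M" and u: "ypart ang u = 0"
    and hL: "\<bar>h\<bar> * L < 1" and start: "norm (ypart ang x0 - y0) + \<bar>h\<bar> * M \<le> R / 2"
  obtains Z where "Z 0 = x0"
    "\<And>s. s \<in> {0..1} \<Longrightarrow> Z s \<in> \<Omega> \<and> (Z has_vector_derivative h *\<^sub>R (u + f (Z s))) (at s within {0..1})"
    "\<And>s. s \<in> {0..1} \<Longrightarrow> norm (ypart ang (Z s) - y0) \<le> norm (ypart ang x0 - y0) + \<bar>h\<bar> * M"
proof -
  define K where "K = ypart ang -` cball y0 (R / 2)"
  have K_iff: "x \<in> K \<longleftrightarrow> norm (ypart ang x - y0) \<le> R / 2" for x
    by (simp add: K_def dist_norm norm_minus_commute)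
  have "closed K"
    unfolding K_def
    by (intro closed_vimage closed_cball bounded_linear.continuous_on[OF bounded_linear_ypart] continuous_on_id)
  have "convex K"
    unfolding K_def by (intro convex_linear_vimage convex_cball bounded_linear.linear[OF bounded_linear_ypart])
  have "ypart ang y0 = y0" using y0 by (auto simp: yspace_def ypart_def vec_eq_iff)
  then have "y0 \<in> K" using R_pos by (simp add: K_iff)
  then have "K \<noteq> {}" by blast
  have K_\<Omega>: "x \<in> \<Omega>" if "x \<in> K" for x using that R_pos by (simp add: K_iff phase_domain_iff)
  let ?\<pi> = "closest_point K"
  have \<pi>: "?\<pi> x \<in> \<Omega>" for x by (rule K_\<Omega>[OF closest_point_in_set[OF \<open>closed K\<close> \<open>K \<noteq> {}\<close>]])
  have M0: "0 \<le> M" using M[OF K_\<Omega>[OF \<open>y0 \<in> K\<close>]] norm_ge_zero order_trans by blast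
  let ?G = "\<lambda>x. h *\<^sub>R (u + f (?\<pi> x))"
  have LipG: "norm (?G x - ?G y) \<le> \<bar>h\<bar> * L * norm (x - y)" for x y
  proof -
    have "norm (f (?\<pi> x) - f (?\<pi> y)) \<le> L * norm (?\<pi> x - ?\<pi> y)" by (rule Lip[OF \<pi> \<pi>])
    also have "\<dots> \<le> L * norm (x - y)"
      using closest_point_lipschitz[OF \<open>convex K\<close> \<open>closed K\<close> \<open>K \<noteq> {}\<close>, of x y] \<open>0 \<le> L\<close>
      by (intro mult_left_mono) (simp_all add: dist_norm)
    finally have "\<bar>h\<bar> * norm (f (?\<pi> x) - f (?\<pi> y)) \<le> \<bar>h\<bar> * (L * norm (x - y))" by (rule mult_left_mono) simp
    then show ?thesis by (simp add: scaleR_diff_right[symmetric] mult.assoc)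
  qed
  obtain Z where Z0: "Z 0 = x0" and Z: "\<And>s. s \<in> {0..1} \<Longrightarrow> (Z has_vector_derivative ?G (Z s)) (at s within {0..1})"
    using autonomous_ivp_solution_exists[OF _ hL LipG] \<open>0 \<le> L\<close> by (metis abs_ge_zero mult_nonneg_nonneg)
  have bound: "norm (ypart ang (Z s) - y0) \<le> norm (ypart ang x0 - y0) + \<bar>h\<bar> * M" if s: "s \<in> {0..1}" for s
  proof -
    have "norm (ypart ang (Z s) - ypart ang (Z 0)) \<le> (\<bar>h\<bar> * M) * \<bar>s - 0\<bar>"
    proof (rule vector_derivative_bound[where S = "{0..1}"])
      fix t :: real assume t: "t \<in> {0..1}"
      show "((\<lambda>t. ypart ang (Z t)) has_vector_derivative ypart ang (?G (Z t))) (at t within {0..1})"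
        by (rule bounded_linear.has_vector_derivative[OF bounded_linear_ypart Z[OF t]])
      have "norm (ypart ang (f (?\<pi> (Z t)))) \<le> M" using norm_ypart_le M[OF \<pi>] order_trans by blast
      then show "norm (ypart ang (?G (Z t))) \<le> \<bar>h\<bar> * M"
        by (simp add: ypart_scaleR ypart_add u mult_left_mono)
    qed (use s in auto)
    also have "\<dots> \<le> (\<bar>h\<bar> * M) * 1" using s M0 by (intro mult_left_mono) auto
    finally show ?thesis
      using norm_triangle_ineq[of "ypart ang (Z s) - ypart ang (Z 0)" "ypart ang (Z 0) - y0"] by (simp add: Z0)
  qed
  have inK: "Z s \<in> K" if "s \<in> {0..1}" for s using bound[OF that] start by (simp add: K_iff)
  show thesis
  proof (rule that[of Z, OF Z0])
    fix s :: real assume s: "s \<in> {0..1}"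
    show "Z s \<in> \<Omega> \<and> (Z has_vector_derivative h *\<^sub>R (u + f (Z s))) (at s within {0..1})"
      using Z[OF s] K_\<Omega>[OF inK[OF s]] by (simp add: closest_point_self[OF inK[OF s]])
    show "norm (ypart ang (Z s) - y0) \<le> norm (ypart ang x0 - y0) + \<bar>h\<bar> * M" by (rule bound[OF s])
  qed
qed

lemma add_state_0_in_\<Omega>: "x + state ang 0 \<omega> \<in> \<Omega> \<longleftrightarrow> x \<in> \<Omega>"
  by (simp add: phase_domain_iff ypart_add ypart_state_0)

lemma flow_unperturbed:
  assumes "x \<in> \<Omega>"
  shows "flow (\<lambda>_. state ang 0 \<omega>) \<Omega> h x = Some (x + h *\<^sub>R state ang 0 \<omega>)"
proof -
  have "flow (\<lambda>_. state ang 0 \<omega>) \<Omega> h x = Some (x + (1 * h) *\<^sub>R state ang 0 \<omega>)"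
  proof (rule flow_eq_Some[where L = 0 and Z = "\<lambda>s. x + (s * h) *\<^sub>R state ang 0 \<omega>"])
    fix s :: real
    have "((\<lambda>s. x + (s * h) *\<^sub>R state ang 0 \<omega>) has_vector_derivative h *\<^sub>R state ang 0 \<omega>) (at s within {0..1})"
      by (auto intro!: derivative_eq_intros)
    then show "x + (s * h) *\<^sub>R state ang 0 \<omega> \<in> \<Omega> \<and>
        ((\<lambda>s. x + (s * h) *\<^sub>R state ang 0 \<omega>) has_vector_derivative h *\<^sub>R state ang 0 \<omega>) (at s within {0..1})"
      using assms add_state_0_in_\<Omega> by (simp add: state_0_scaleR[symmetric])
  qed auto
  then show ?thesis by simp
qed

end

section \<open>Complex conjugation of words\<close>

definition conj_vec :: "complex ^ 'n \<Rightarrow> complex ^ 'n" where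
  "conj_vec v = (\<chi> i. cnj (v $ i))"

lemma conj_vec_nth: "conj_vec v $ j = cnj (v $ j)"
  by (simp add: conj_vec_def)

lemma bounded_linear_conj_vec: "bounded_linear conj_vec"
  by (rule bounded_linear_intro[where K = 1])
    (simp_all add: conj_vec_def vec_eq_iff norm_vec_def)

lemma conj_vec_smult: "conj_vec (c *s v) = cnj c *s conj_vec v"
  by (simp add: conj_vec_def vec_eq_iff)

lemma conj_vec_sum: "conj_vec (\<Sum>a\<in>A. g a) = (\<Sum>a\<in>A. conj_vec (g a))"
  by (rule linear_sum[OF bounded_linear.linear[OF bounded_linear_conj_vec]])

lemma kdot_uminus: "kdot (- k) v = - kdot k v"
  by (simp add: kdot_def sum_negf)

lemma iterated_integral_uminus:
  "iterated_integral (map uminus bs) T = cnj (iterated_integral bs T)"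
proof (induction bs arbitrary: T)
  case (Cons \<beta> bs)
  have "iterated_integral (map uminus (\<beta> # bs)) T =
      integral {0..T} (\<lambda>s. cnj (exp (\<i> * complex_of_real (s * \<beta>)) * iterated_integral bs s))"
    by (simp add: Cons exp_cnj)
  also have "\<dots> = cnj (iterated_integral (\<beta> # bs) T)" by (simp add: integral_cnj)
  finally show ?case .
qed simp

lemma exact_coeff_uminus: "exact_coeff \<omega> (map uminus w) h = cnj (exact_coeff \<omega> w h)"
proof -
  have "rev (map (\<lambda>k. kdot k \<omega> * h) (map uminus w)) = map uminus (rev (map (\<lambda>k. kdot k \<omega> * h) w))"
    by (simp add: rev_map kdot_uminus)
  then show ?thesis by (simp add: exact_coeff_eq_iterated iterated_integral_uminus)
qed

lemma split_coeff_uminus: "split_coeff r a b \<omega> (map uminus w) h = cnj (split_coeff r a b \<omega> w h)"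
proof -
  have "cnj (exp (\<i> * complex_of_real x)) = exp (\<i> * complex_of_real (- x))" for x by (simp add: exp_cnj)
  moreover have "(\<Sum>i<length w. (\<Sum>l=1..js ! i. a l) * kdot (map uminus w ! i) \<omega>) * h =
      - ((\<Sum>i<length w. (\<Sum>l=1..js ! i. a l) * kdot (w ! i) \<omega>) * h)" for js
    by (simp add: kdot_uminus sum_negf)
  ultimately show ?thesis
    unfolding split_coeff_def by (simp only: cnj_sum complex_cnj_mult complex_cnj_complex_of_real length_map)
qed

context oscillatory_field
begin

text \<open>
  Words with a letter outside \<open>I\<close> contribute nothing, which allows \<open>I\<close> to be enlarged to a set that
  is symmetric under \<open>k \<mapsto> - k\<close>.
\<close>

lemma word_basis_eq_0:
  "k \<in> set w \<Longrightarrow> k \<notin> I \<Longrightarrow> length w \<le> N \<Longrightarrow> x \<in> \<Omega> \<Longrightarrow> word_basis ang fhat w x = 0"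
proof (induction w arbitrary: x rule: induct_list012)
  case (2 l)
  then show ?case using support[of k "ypart ang x"] by (auto simp: mode_def phase_domain_def)
next
  case (3 l j w)
  have "bounded_Ck UNIV \<Omega> (Suc (N - length (l # j # w))) (word_basis ang fhat (j # w))"
    using bounded_Ck_word_basis[of "j # w"] 3(5) by (simp add: Suc_diff_Suc del: bounded_Ck.simps)
  note eq = word_basis_Cons[OF this \<open>x \<in> \<Omega>\<close>, of l]
  show ?case
  proof (cases "k = l")
    case True
    then have "mode ang fhat l x = 0"
      using 3 support[of k "ypart ang x"] by (auto simp: mode_def phase_domain_def)
    then show ?thesis unfolding eq by simp
  next
    case False
    then have "word_basis ang fhat (j # w) z = 0" if "z \<in> \<Omega>" for z
      using 3 that by (intro 3(2)) auto
    then have "partial i (word_basis ang fhat (j # w)) x = partial i (\<lambda>_. 0) x" for i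
      by (intro partial_cong_open[OF open_\<Omega> \<open>x \<in> \<Omega>\<close>])
    moreover have "partial i (\<lambda>_. 0) x = (0 :: complex ^ 'n)" for i by (intro partial_eqI) simp
    ultimately show ?thesis unfolding eq by simp
  qed
qed simp

lemma mode_uminus: "x \<in> \<Omega> \<Longrightarrow> mode ang fhat (- k) x = conj_vec (mode ang fhat k x)"
  using conj_sym[of "ypart ang x" k]
  by (simp add: mode_def conj_vec_def vec_eq_iff phase_domain_def kdot_uminus exp_cnj)

lemma word_basis_uminus:
  "w \<noteq> [] \<Longrightarrow> length w \<le> N \<Longrightarrow> x \<in> \<Omega> \<Longrightarrow>
    word_basis ang fhat (map uminus w) x = conj_vec (word_basis ang fhat w x)"
proof (induction w arbitrary: x rule: induct_list012)
  case (2 k)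
  then show ?case by (simp add: mode_uminus)
next
  case (3 k l w)
  let ?m = "N - length (k # l # w)"
  let ?g = "word_basis ang fhat (l # w)" and ?g' = "word_basis ang fhat (map uminus (l # w))"
  have g: "bounded_Ck UNIV \<Omega> (Suc ?m) ?g"
    using bounded_Ck_word_basis[of "l # w"] 3(4) by (simp add: Suc_diff_Suc del: bounded_Ck.simps)
  have g': "bounded_Ck UNIV \<Omega> (Suc ?m) ?g'"
    using bounded_Ck_word_basis[of "map uminus (l # w)"] 3(4) by (simp add: Suc_diff_Suc del: bounded_Ck.simps)
  have p: "partial j ?g' x = conj_vec (partial j ?g x)" for j
  proof -
    have "partial j ?g' x = partial j (\<lambda>z. conj_vec (?g z)) x"
      using 3 by (intro partial_cong_open[OF open_\<Omega> \<open>x \<in> \<Omega>\<close>] 3(2)) auto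
    also have "\<dots> = conj_vec (partial j ?g x)"
      by (intro partial_eqI bounded_linear.has_vector_derivative[OF bounded_linear_conj_vec]
          bounded_Ck_has_partial[OF g] \<open>x \<in> \<Omega>\<close> UNIV_I)
    finally show ?thesis .
  qed
  have "word_basis ang fhat (map uminus (k # l # w)) x =
      (\<Sum>j\<in>UNIV. (mode ang fhat (- k) x $ j) *s partial j ?g' x)"
    using word_basis_Cons[of ?m "- l" "map uminus w" x "- k"] g' \<open>x \<in> \<Omega>\<close> by simp
  also have "\<dots> = (\<Sum>j\<in>UNIV. conj_vec ((mode ang fhat k x $ j) *s partial j ?g x))"
    by (simp only: p conj_vec_smult mode_uminus[OF \<open>x \<in> \<Omega>\<close>] conj_vec_nth)
  also have "\<dots> = conj_vec (word_basis ang fhat (k # l # w) x)"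
    unfolding word_basis_Cons[OF g \<open>x \<in> \<Omega>\<close>] by (rule conj_vec_sum[symmetric])
  finally show ?case .
qed simp

text \<open>
  Conjugation replaces the term of the word \<open>w\<close> by that of \<open>map uminus w\<close>, hence permutes the terms
  of a sum over the words in a symmetric alphabet.
\<close>

lemma conj_vec_word_sum:
  assumes "0 < n" "n \<le> N" "x \<in> \<Omega>" and \<gamma>: "\<And>w. \<gamma> (map uminus w) = cnj (\<gamma> w)"
  shows "conj_vec (\<Sum>w\<in>{w. length w = n \<and> set w \<subseteq> I}. \<gamma> w *s word_basis ang fhat w x) =
    (\<Sum>w\<in>{w. length w = n \<and> set w \<subseteq> I}. \<gamma> w *s word_basis ang fhat w x)"
proof -
  \<comment> \<open>The index set \<open>I\<close> itself need not be symmetric.\<close>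
  define J where "J = I \<union> uminus ` I"
  have "uminus ` J = J" by (simp add: J_def image_Un image_image Un_commute)
  have "finite J" using finite_I by (simp add: J_def)
  let ?W = "\<lambda>K. {w :: (int ^ 'd) list. length w = n \<and> set w \<subseteq> K}"
  let ?F = "\<lambda>w. \<gamma> w *s word_basis ang fhat w x"
  have extend: "(\<Sum>w\<in>?W I. ?F w) = (\<Sum>w\<in>?W J. ?F w)"
  proof (rule sum.mono_neutral_left)
    show "finite (?W J)" using finite_lists_length_eq[OF \<open>finite J\<close>, of n] by (simp add: conj_commute)
    show "?W I \<subseteq> ?W J" by (auto simp: J_def)
    show "\<forall>w\<in>?W J - ?W I. ?F w = 0"
      using word_basis_eq_0 assms by fastforce
  qed
  have "conj_vec (\<Sum>w\<in>?W J. ?F w) = (\<Sum>w\<in>?W J. ?F (map uminus w))"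
    unfolding conj_vec_sum
  proof (rule sum.cong[OF refl])
    fix w assume "w \<in> ?W J"
    then have "w \<noteq> []" "length w \<le> N" using assms by auto
    then show "conj_vec (?F w) = ?F (map uminus w)"
      by (simp add: conj_vec_smult \<gamma> word_basis_uminus \<open>x \<in> \<Omega>\<close>)
  qed
  also have "\<dots> = (\<Sum>w\<in>?W J. ?F w)"
    by (rule sum.reindex_bij_witness[of _ "map uminus" "map uminus"])
      (use \<open>uminus ` J = J\<close> in \<open>auto simp: comp_def\<close>)
  finally show ?thesis unfolding extend .
qed

end

section \<open>Expansions of the exact and of the numerical solution\<close>

lemma sum_words_below_graded:
  fixes F :: "'k list \<Rightarrow> 'a::comm_monoid_add"
  assumes "finite K" "0 < N"
  shows "(\<Sum>v\<in>words_below K N. F v) = F [] + (\<Sum>n=1..N-1. \<Sum>w\<in>{w. length w = n \<and> set w \<subseteq> K}. F w)"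
proof -
  let ?W = "\<lambda>n. {w. length w = n \<and> set w \<subseteq> K}"
  have fin: "finite (?W n)" for n using finite_lists_length_eq[OF assms(1), of n] by (simp add: conj_commute)
  have "words_below K N = (\<Union>n\<in>{..<N}. ?W n)" by (auto simp: words_below_def)
  then have "(\<Sum>v\<in>words_below K N. F v) = (\<Sum>n<N. \<Sum>w\<in>?W n. F w)"
    using fin by (simp only:) (rule sum.UNION_disjoint, auto)
  also have "{..<N} = insert 0 {1..N-1}" using assms(2) by auto
  also have "(\<Sum>n\<in>insert 0 {1..N-1}. \<Sum>w\<in>?W n. F w) = (\<Sum>w\<in>?W 0. F w) + (\<Sum>n=1..N-1. \<Sum>w\<in>?W n. F w)"
    by (rule sum.insert) auto
  also have "?W 0 = {[]}" by auto
  finally show ?thesis by simp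
qed

lemma norm_stage_coeff: "cmod (stage_coeff \<beta> c \<omega> h v) \<le> \<bar>\<beta>\<bar> ^ length v"
proof -
  have "cmod (stage_coeff \<beta> c \<omega> h v) = \<bar>\<beta>\<bar> ^ length v / fact (length v)"
    by (simp add: stage_coeff_def norm_mult norm_divide norm_power)
  also have "\<dots> \<le> \<bar>\<beta>\<bar> ^ length v / 1" by (intro divide_left_mono) simp_all
  finally show ?thesis by simp
qed

lemma split_convolution_graded:
  "split_convolution (\<lambda>u. complex_of_real (h ^ length u) * c u) (\<lambda>v. complex_of_real (h ^ length v) * c' v) w =
    complex_of_real (h ^ length w) * split_convolution c c' w"
proof -
  have "(complex_of_real (h ^ length (take i w)) * c (take i w)) * (complex_of_real (h ^ length (drop i w)) * c' (drop i w)) =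
      complex_of_real (h ^ length w) * (c (take i w) * c' (drop i w))" if "i \<le> length w" for i
  proof -
    have "h ^ length (take i w) * h ^ length (drop i w) = h ^ length w"
      using that by (simp add: power_add[symmetric])
    then have "complex_of_real (h ^ length (take i w)) * complex_of_real (h ^ length (drop i w)) = complex_of_real (h ^ length w)"
      by (metis of_real_mult)
    moreover have "(x * c (take i w)) * (y * c' (drop i w)) = (x * y) * (c (take i w) * c' (drop i w))" for x y
      by (simp only: mult_ac)
    ultimately show ?thesis by (simp only:)
  qed
  then show ?thesis
    unfolding split_convolution_def sum_distrib_left by (intro sum.cong refl) simp
qed

context oscillatory_field
begin

text \<open>
  The only place where \<open>\<omega>\<close> enters the equation: as a phase factor of modulus one.
\<close>

lemma cvec_field_shifted:
  assumes "z \<in> \<Omega>"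
  shows "cvec (\<beta> *\<^sub>R f (z + \<tau> *\<^sub>R state ang 0 \<omega>)) =
    (\<Sum>k\<in>I. (complex_of_real \<beta> * exp (\<i> * complex_of_real (\<tau> * kdot k \<omega>))) *s mode ang fhat k z)"
proof -
  have "cvec (\<beta> *\<^sub>R f (z + \<tau> *\<^sub>R state ang 0 \<omega>)) = complex_of_real \<beta> *s cvec (f (z + state ang 0 (\<tau> *\<^sub>R \<omega>)))"
    by (simp add: state_0_scaleR of_real_smult linear_scale[OF bounded_linear.linear[OF bounded_linear_cvec]])
  also have "\<dots> = complex_of_real \<beta> *s (\<Sum>k\<in>I. exp (\<i> * complex_of_real (\<tau> * kdot k \<omega>)) *s mode ang fhat k z)"
    using assms by (simp add: field_eq_sum_modes add_state_0_in_\<Omega> mode_add_angles kdot_scaleR)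
  finally show ?thesis by (simp add: smult_sum_right vector_smult_assoc)
qed

text \<open>
  The two applications differ in the drift \<open>\<tau>\<close>: it grows linearly along the exact solution, and it is
  constant during one stage of the integrator.
\<close>

lemma shifted_path_expansion:
  fixes C \<beta> :: real
  assumes bound: "\<And>w x. set w \<subseteq> I \<Longrightarrow> length w = N \<Longrightarrow> x \<in> \<Omega> \<Longrightarrow> norm (extended_basis w x) \<le> C"
    and z: "\<And>s. s \<in> {0..1} \<Longrightarrow> z s \<in> \<Omega>"
      "\<And>s. s \<in> {0..1} \<Longrightarrow> (z has_vector_derivative \<beta> *\<^sub>R f (z s + \<tau> s *\<^sub>R state ang 0 \<omega>)) (at s within {0..1})"
    and J_Nil: "\<And>s. J [] s = 1" and J_0: "\<And>v k. J (v @ [k]) 0 = 0"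
    and J_deriv: "\<And>v k s. s \<in> {0..1} \<Longrightarrow> (J (v @ [k]) has_vector_derivative
        (complex_of_real \<beta> * exp (\<i> * complex_of_real (\<tau> s * kdot k \<omega>))) * J v s) (at s within {0..1})"
    and w: "set w \<subseteq> I" "length w \<le> N"
  shows "norm (extended_basis w (z 1) - (\<Sum>v\<in>words_below I (N - length w). J v 1 *s extended_basis (v @ w) (z 0)))
    \<le> C * (card I * \<bar>\<beta>\<bar>) ^ (N - length w)"
proof (rule word_expansion[where \<alpha> = "\<lambda>k s. complex_of_real \<beta> * exp (\<i> * complex_of_real (\<tau> s * kdot k \<omega>))" and J = J])
  show "((\<lambda>t. extended_basis w (z t)) has_vector_derivative
      (\<Sum>k\<in>I. (complex_of_real \<beta> * exp (\<i> * complex_of_real (\<tau> s * kdot k \<omega>))) *s extended_basis (k # w) (z s)))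
      (at s within {0..1})" if "length w < N" "s \<in> {0..1}" for w s
    by (rule extended_basis_has_vector_derivative[OF that(1) z(1)[OF that(2)] z(2)[OF that(2)] cvec_field_shifted[OF z(1)[OF that(2)]]])
qed (use assms finite_I in \<open>auto simp: norm_mult simp del: of_real_mult\<close>)

lemma exact_path_expansion:
  fixes C h :: real
  assumes bound: "\<And>w x. set w \<subseteq> I \<Longrightarrow> length w = N \<Longrightarrow> x \<in> \<Omega> \<Longrightarrow> norm (extended_basis w x) \<le> C"
    and Z0: "Z 0 = x0"
    and Z: "\<And>s. s \<in> {0..1} \<Longrightarrow> Z s \<in> \<Omega> \<and>
      (Z has_vector_derivative h *\<^sub>R (state ang 0 \<omega> + f (Z s))) (at s within {0..1})"
    and w: "set w \<subseteq> I" "length w \<le> N"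
  shows "norm (extended_basis w (Z 1 - h *\<^sub>R state ang 0 \<omega>) - (\<Sum>v\<in>words_below I (N - length w).
      (complex_of_real (h ^ length v) * exact_coeff \<omega> v h) *s extended_basis (v @ w) x0)) \<le> C * (card I * \<bar>h\<bar>) ^ (N - length w)"
proof -
  let ?z = "\<lambda>s. Z s - (s * h) *\<^sub>R state ang 0 \<omega>"
  let ?J = "\<lambda>v s. complex_of_real (h ^ length v) * iterated_integral (rev (map (\<lambda>k. kdot k \<omega> * h) v)) s"
  have "norm (extended_basis w (?z 1) - (\<Sum>v\<in>words_below I (N - length w). ?J v 1 *s extended_basis (v @ w) (?z 0)))
      \<le> C * (card I * \<bar>h\<bar>) ^ (N - length w)"
  proof (rule shifted_path_expansion[OF bound, where \<tau> = "\<lambda>s. s * h" and \<omega> = \<omega>])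
    fix s :: real assume s: "s \<in> {0..1}"
    show "?z s \<in> \<Omega>"
      using Z[OF s] add_state_0_in_\<Omega>[of "Z s" "(- (s * h)) *\<^sub>R \<omega>"] by (simp only: state_0_scaleR) simp
    have "(?z has_vector_derivative h *\<^sub>R (state ang 0 \<omega> + f (Z s)) - h *\<^sub>R state ang 0 \<omega>) (at s within {0..1})"
      using Z[OF s] by (auto intro!: derivative_eq_intros)
    then show "(?z has_vector_derivative h *\<^sub>R f (?z s + (s * h) *\<^sub>R state ang 0 \<omega>)) (at s within {0..1})"
      by (simp add: scaleR_add_right)
    fix v and k :: "int ^ 'd"
    have "(iterated_integral (kdot k \<omega> * h # rev (map (\<lambda>k. kdot k \<omega> * h) v)) has_vector_derivative
        exp (\<i> * complex_of_real (s * (kdot k \<omega> * h))) * iterated_integral (rev (map (\<lambda>k. kdot k \<omega> * h) v)) s)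
        (at s within {0..1})"
      by (rule iterated_integral_has_vector_derivative[OF s])
    from has_vector_derivative_mult_right[OF this, of "complex_of_real (h ^ length (v @ [k]))"]
    show "(?J (v @ [k]) has_vector_derivative
        (complex_of_real h * exp (\<i> * complex_of_real (s * h * kdot k \<omega>))) * ?J v s) (at s within {0..1})"
      by (simp add: mult_ac)
  qed (use w in auto)
  then show ?thesis by (simp add: Z0 exact_coeff_eq_iterated)
qed

lemma stage_path_expansion:
  fixes C h c \<beta> :: real
  assumes bound: "\<And>w x. set w \<subseteq> I \<Longrightarrow> length w = N \<Longrightarrow> x \<in> \<Omega> \<Longrightarrow> norm (extended_basis w x) \<le> C"
    and Z0: "Z 0 = z0 + (h * c) *\<^sub>R state ang 0 \<omega>"
    and Z: "\<And>s. s \<in> {0..1} \<Longrightarrow> Z s \<in> \<Omega> \<and> (Z has_vector_derivative (\<beta> * h) *\<^sub>R f (Z s)) (at s within {0..1})"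
    and w: "set w \<subseteq> I" "length w \<le> N"
  shows "norm (extended_basis w (Z 1 - (h * c) *\<^sub>R state ang 0 \<omega>) - (\<Sum>v\<in>words_below I (N - length w).
      (complex_of_real (h ^ length v) * stage_coeff \<beta> c \<omega> h v) *s extended_basis (v @ w) z0))
    \<le> C * (card I * \<bar>\<beta> * h\<bar>) ^ (N - length w)"
proof -
  let ?z = "\<lambda>s. Z s - (h * c) *\<^sub>R state ang 0 \<omega>"
  let ?J = "\<lambda>v s. (complex_of_real (h ^ length v) * stage_coeff \<beta> c \<omega> h v) * complex_of_real (s ^ length v)"
  have "norm (extended_basis w (?z 1) - (\<Sum>v\<in>words_below I (N - length w). ?J v 1 *s extended_basis (v @ w) (?z 0)))
      \<le> C * (card I * \<bar>\<beta> * h\<bar>) ^ (N - length w)"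
  proof (rule shifted_path_expansion[OF bound, where \<tau> = "\<lambda>s. h * c" and \<omega> = \<omega>])
    fix s :: real assume s: "s \<in> {0..1}"
    show "?z s \<in> \<Omega>"
      using Z[OF s] add_state_0_in_\<Omega>[of "Z s" "(- (h * c)) *\<^sub>R \<omega>"] by (simp only: state_0_scaleR) simp
    have "(?z has_vector_derivative (\<beta> * h) *\<^sub>R f (Z s) - 0) (at s within {0..1})"
      using Z[OF s] by (intro has_vector_derivative_diff has_vector_derivative_const) auto
    then show "(?z has_vector_derivative (\<beta> * h) *\<^sub>R f (?z s + (h * c) *\<^sub>R state ang 0 \<omega>)) (at s within {0..1})"
      by simp
    fix v :: "(int ^ 'd) list" and k
    let ?n = "length v"
    let ?K = "complex_of_real (h ^ Suc ?n) * stage_coeff \<beta> c \<omega> h (v @ [k])"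
    have "((\<lambda>s. complex_of_real (s ^ Suc ?n)) has_vector_derivative complex_of_real (Suc ?n * s ^ ?n)) (at s within {0..1})"
      using DERIV_pow[of "Suc ?n" s "{0..1}"]
      by (intro has_vector_derivative_of_real) (simp add: has_real_derivative_iff_has_vector_derivative)
    from has_vector_derivative_mult_right[OF this, of ?K]
    have "(?J (v @ [k]) has_vector_derivative ?K * complex_of_real (Suc ?n * s ^ ?n)) (at s within {0..1})"
      by simp
    moreover have "?K * complex_of_real (Suc ?n) = (complex_of_real (\<beta> * h) * exp (\<i> * complex_of_real (h * c * kdot k \<omega>)))
        * (complex_of_real (h ^ ?n) * stage_coeff \<beta> c \<omega> h v)"
    proof -
      have e: "exp (\<i> * complex_of_real (c * (\<Sum>k\<leftarrow>v @ [k]. kdot k \<omega>) * h)) =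
          exp (\<i> * complex_of_real (h * c * kdot k \<omega>)) * exp (\<i> * complex_of_real (c * (\<Sum>k\<leftarrow>v. kdot k \<omega>) * h))"
        by (simp add: exp_add[symmetric] algebra_simps)
      have "\<beta> ^ length (v @ [k]) / fact (length (v @ [k])) * Suc ?n = \<beta> * (\<beta> ^ ?n / fact ?n)"
        by (simp del: of_nat_Suc)
      then have r: "complex_of_real (\<beta> ^ length (v @ [k]) / fact (length (v @ [k]))) * complex_of_real (Suc ?n) =
          complex_of_real \<beta> * complex_of_real (\<beta> ^ ?n / fact ?n)"
        by (simp only: of_real_mult[symmetric])
      have h: "complex_of_real (h ^ Suc ?n) = complex_of_real h * complex_of_real (h ^ ?n)" by simp
      have "?K * complex_of_real (Suc ?n) = complex_of_real (h ^ Suc ?n) *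
          ((complex_of_real (\<beta> ^ length (v @ [k]) / fact (length (v @ [k]))) * complex_of_real (Suc ?n)) *
           exp (\<i> * complex_of_real (c * (\<Sum>k\<leftarrow>v @ [k]. kdot k \<omega>) * h)))"
        unfolding stage_coeff_def by (simp only: mult_ac)
      also have "\<dots> = (complex_of_real (\<beta> * h) * exp (\<i> * complex_of_real (h * c * kdot k \<omega>)))
          * (complex_of_real (h ^ ?n) * stage_coeff \<beta> c \<omega> h v)"
        unfolding r e h stage_coeff_def of_real_mult[of \<beta> h] by (simp only: mult_ac)
      finally show ?thesis .
    qed
    ultimately show "(?J (v @ [k]) has_vector_derivative
        (complex_of_real (\<beta> * h) * exp (\<i> * complex_of_real (h * c * kdot k \<omega>))) * ?J v s) (at s within {0..1})"
      by (simp only: of_real_mult[of "real (Suc ?n)"] mult.assoc[symmetric])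
  qed (use w in \<open>auto simp: stage_coeff_def\<close>)
  then show ?thesis by (simp add: Z0)
qed

end

lemma sum_words_below_indicator_Nil:
  assumes "finite K" "0 < p"
  shows "(\<Sum>v\<in>words_below K p. (g v * (if v = [] then 1 else 0)) *s (F v :: complex ^ 'n)) = g [] *s F []"
proof -
  have "(\<Sum>v\<in>words_below K p. (g v * (if v = [] then 1 else 0)) *s F v) =
      (\<Sum>v\<in>words_below K p. if v = [] then g [] *s F [] else 0)"
    by (intro sum.cong refl) simp
  moreover have "[] \<in> words_below K p" using assms(2) by (simp add: words_below_def)
  ultimately show ?thesis using finite_words_below[OF assms(1), of p] by simp
qed

context oscillatory_field
begin

text \<open>
  The induction hypothesis on the number \<open>m\<close> of stages.  The point \<open>z\<close> is the numerical solution with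
  the drift of the angles removed.  The bound on \<open>y\<close> guarantees that the next stage is defined, and
  the expansion is required for all words \<open>w\<close>, as the composition of expansions needs it.
\<close>

definition splitting_expands ::
  "(nat \<Rightarrow> real) \<Rightarrow> (nat \<Rightarrow> real) \<Rightarrow> real \<Rightarrow> real \<Rightarrow> nat \<Rightarrow> real ^ 'd \<Rightarrow> real \<Rightarrow> real ^ 'n \<Rightarrow> bool"
where
  "splitting_expands a b M C' m \<omega> h x0 \<longleftrightarrow>
    (\<exists>z. splitting (\<lambda>_. state ang 0 \<omega>) f \<Omega> a b h m x0 = Some (z + (h * (\<Sum>j=1..m. a j)) *\<^sub>R state ang 0 \<omega>) \<and>
      norm (ypart ang z - y0) \<le> \<bar>h\<bar> * (\<Sum>j=1..m. \<bar>b j\<bar>) * M \<and>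
      (\<forall>w. set w \<subseteq> I \<longrightarrow> length w \<le> N \<longrightarrow>
        norm (extended_basis w z - (\<Sum>v\<in>words_below I (N - length w).
          (complex_of_real (h ^ length v) * split_coeff m a b \<omega> v h) *s extended_basis (v @ w) x0))
        \<le> C' * \<bar>h\<bar> ^ (N - length w)))"

text \<open>
  Each stage is composed with the expansion of the stages before it.  The constant stays uniform in
  \<open>\<omega>\<close>, \<open>h\<close> and \<open>x0\<close> because the coefficients of a stage are bounded by \<open>\<bar>b j * h\<bar> ^ length v\<close>.
\<close>

lemma splitting_expansion:
  fixes a b :: "nat \<Rightarrow> real" and C L M :: real
  assumes bound: "\<And>w x. set w \<subseteq> I \<Longrightarrow> length w = N \<Longrightarrow> x \<in> \<Omega> \<Longrightarrow> norm (extended_basis w x) \<le> C" and "C \<ge> 0"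
    and Lip: "\<And>x y. x \<in> \<Omega> \<Longrightarrow> y \<in> \<Omega> \<Longrightarrow> norm (f x - f y) \<le> L * norm (x - y)" and "0 \<le> L"
    and M: "\<And>x. x \<in> \<Omega> \<Longrightarrow> norm (f x) \<le> M" and "0 \<le> M"
  shows "\<exists>C'\<ge>0. \<forall>\<omega> h x0. ypart ang x0 = y0 \<longrightarrow> \<bar>h\<bar> * (\<Sum>j=1..m. \<bar>b j\<bar>) * M \<le> R / 2 \<longrightarrow>
      \<bar>h\<bar> * (\<Sum>j=1..m. \<bar>b j\<bar>) * L < 1 \<longrightarrow>
      splitting_expands a b M C' m \<omega> h x0"
proof (induction m)
  case 0
  show ?case
  proof (intro exI[of _ C] conjI allI impI)
    fix \<omega> :: "real ^ 'd" and h x0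
    assume x0: "ypart ang x0 = y0"
    have "norm (extended_basis w x0 - (\<Sum>v\<in>words_below I (N - length w).
        (complex_of_real (h ^ length v) * split_coeff 0 a b \<omega> v h) *s extended_basis (v @ w) x0)) \<le> C * \<bar>h\<bar> ^ (N - length w)"
      if w: "set w \<subseteq> I" "length w \<le> N" for w
    proof (cases "length w = N")
      case True
      then show ?thesis
        using bound[OF w(1) True, of x0] x0 R_pos by (simp add: words_below_def phase_domain_iff)
    next
      case False
      then have "0 < N - length w" using w by simp
      then have "(\<Sum>v\<in>words_below I (N - length w).
          (complex_of_real (h ^ length v) * split_coeff 0 a b \<omega> v h) *s extended_basis (v @ w) x0) = extended_basis w x0"
        unfolding split_coeff_0 using finite_I by (subst sum_words_below_indicator_Nil) simp_all
      then show ?thesis using \<open>C \<ge> 0\<close> by simp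
    qed
    then show "splitting_expands a b M C 0 \<omega> h x0"
      unfolding splitting_expands_def using x0 by (intro exI[of _ x0]) simp
  qed fact
next
  case (Suc m)
  let ?u = "\<lambda>\<omega> :: real ^ 'd. state ang 0 \<omega> :: real ^ 'n"
  let ?s = "\<lambda>m. \<Sum>j=1..m. \<bar>b j\<bar>" and ?c = "\<lambda>m. \<Sum>j=1..m. a j"
  let ?\<beta> = "b (Suc m)"
  let ?coeff = "\<lambda>m \<omega> h v. complex_of_real (h ^ length v) * split_coeff m a b \<omega> v h"
  obtain C1 where "C1 \<ge> 0" and C1: "\<And>\<omega> h x0. ypart ang x0 = y0 \<Longrightarrow> \<bar>h\<bar> * ?s m * M \<le> R / 2 \<Longrightarrow>
      \<bar>h\<bar> * ?s m * L < 1 \<Longrightarrow>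
      splitting_expands a b M C1 m \<omega> h x0"
    using Suc.IH by blast
  \<comment> \<open>The summand 1 makes the powers monotone in the exponent, so that one constant serves all lengths of words.\<close>
  define C2 where "C2 = C * (1 + card I * \<bar>?\<beta>\<bar>) ^ N"
  define D where "D = (1 + \<bar>?\<beta>\<bar>) ^ N"
  have "C2 \<ge> 0" "D \<ge> 0" using \<open>C \<ge> 0\<close> by (simp_all add: C2_def D_def)
  let ?C' = "C2 + card (words_below I N) * (D * C1)"
  show ?case
  proof (intro exI[of _ ?C'] conjI allI impI)
    show "0 \<le> ?C'" using \<open>C1 \<ge> 0\<close> \<open>C2 \<ge> 0\<close> \<open>D \<ge> 0\<close> by simp
    fix \<omega> :: "real ^ 'd" and h x0
    assume x0: "ypart ang x0 = y0" and hM: "\<bar>h\<bar> * ?s (Suc m) * M \<le> R / 2" and hL: "\<bar>h\<bar> * ?s (Suc m) * L < 1"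
    have sM: "\<bar>h\<bar> * ?s (Suc m) * M = \<bar>h\<bar> * ?s m * M + \<bar>?\<beta> * h\<bar> * M"
      and sL: "\<bar>h\<bar> * ?s (Suc m) * L = \<bar>h\<bar> * ?s m * L + \<bar>?\<beta> * h\<bar> * L"
      by (simp_all add: abs_mult algebra_simps)
    have nonneg: "0 \<le> \<bar>h\<bar> * ?s m * M" "0 \<le> \<bar>h\<bar> * ?s m * L" "0 \<le> \<bar>?\<beta> * h\<bar> * M" "0 \<le> \<bar>?\<beta> * h\<bar> * L"
      using \<open>0 \<le> M\<close> \<open>0 \<le> L\<close> by (simp_all add: sum_nonneg)
    have "\<bar>h\<bar> * ?s m * M \<le> R / 2" "\<bar>h\<bar> * ?s m * L < 1" using hM hL sM sL nonneg by linarith+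
    from C1[OF x0 this, of \<omega>] obtain z where z: "splitting (\<lambda>_. ?u \<omega>) f \<Omega> a b h m x0 = Some (z + (h * ?c m) *\<^sub>R ?u \<omega>)"
        "norm (ypart ang z - y0) \<le> \<bar>h\<bar> * ?s m * M"
        "\<And>w. set w \<subseteq> I \<Longrightarrow> length w \<le> N \<Longrightarrow>
          norm (extended_basis w z - (\<Sum>v\<in>words_below I (N - length w). ?coeff m \<omega> h v *s extended_basis (v @ w) x0))
          \<le> C1 * \<bar>h\<bar> ^ (N - length w)"
      unfolding splitting_expands_def by blast
    have "z \<in> \<Omega>" using z(2) hM sM nonneg R_pos by (simp add: phase_domain_iff)
    let ?x = "z + (h * ?c m) *\<^sub>R ?u \<omega>" and ?x' = "z + (h * ?c (Suc m)) *\<^sub>R ?u \<omega>"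
    have "?x \<in> \<Omega>" using \<open>z \<in> \<Omega>\<close> by (simp add: state_0_scaleR[symmetric] add_state_0_in_\<Omega>)
    then have flowU: "flow (\<lambda>_. ?u \<omega>) \<Omega> (a (Suc m) * h) ?x = Some ?x'"
      by (simp add: flow_unperturbed algebra_simps)
    have ypart_x': "ypart ang ?x' = ypart ang z" by (simp add: ypart_add ypart_scaleR ypart_state_0)
    have stage_L: "\<bar>?\<beta> * h\<bar> * L < 1" using hL sL nonneg by linarith
    obtain Z where Z0: "Z 0 = ?x'"
      and Z: "\<And>s. s \<in> {0..1} \<Longrightarrow> Z s \<in> \<Omega> \<and> (Z has_vector_derivative (?\<beta> * h) *\<^sub>R (0 + f (Z s))) (at s within {0..1})"
      and Zb: "\<And>s. s \<in> {0..1} \<Longrightarrow> norm (ypart ang (Z s) - y0) \<le> norm (ypart ang ?x' - y0) + \<bar>?\<beta> * h\<bar> * M"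
    proof (rule perturbed_path_exists[OF Lip \<open>0 \<le> L\<close> M, of 0 "?\<beta> * h" ?x'])
      show "ypart ang 0 = 0" by (simp add: ypart_def vec_eq_iff)
      show "\<bar>?\<beta> * h\<bar> * L < 1" by (rule stage_L)
      show "norm (ypart ang ?x' - y0) + \<bar>?\<beta> * h\<bar> * M \<le> R / 2" using hM sM z(2) unfolding ypart_x' by linarith
    qed auto
    have flowP: "flow f \<Omega> (?\<beta> * h) ?x' = Some (Z 1)"
      by (rule flow_eq_Some[where F = f and Z = Z and L = L]) (use stage_L Z Z0 Lip \<open>0 \<le> L\<close> in auto)
    \<comment> \<open>The angles have drifted for the time \<open>h * ?c (Suc m)\<close> when the stage starts, and not during the stage.\<close>
    let ?z' = "Z 1 - (h * ?c (Suc m)) *\<^sub>R ?u \<omega>"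
    show "splitting_expands a b M ?C' (Suc m) \<omega> h x0"
      unfolding splitting_expands_def
    proof (intro exI[of _ ?z'] conjI allI impI)
      show "splitting (\<lambda>_. ?u \<omega>) f \<Omega> a b h (Suc m) x0 = Some (?z' + (h * ?c (Suc m)) *\<^sub>R ?u \<omega>)"
        using z(1) flowU flowP by (simp del: sum.cl_ivl_Suc)
      have "ypart ang ?z' = ypart ang (Z 1)"
        using ypart_add[of ang ?z' "(h * ?c (Suc m)) *\<^sub>R ?u \<omega>"] by (simp add: ypart_scaleR ypart_state_0)
      then show "norm (ypart ang ?z' - y0) \<le> \<bar>h\<bar> * ?s (Suc m) * M"
        using Zb[of 1] z(2) sM unfolding ypart_x' by simp
      fix w assume w: "set w \<subseteq> I" "length w \<le> N"
      let ?stage = "stage_coeff ?\<beta> (?c (Suc m)) \<omega> h"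
      have "norm (extended_basis w ?z' - (\<Sum>v\<in>words_below I (N - length w).
          split_convolution (?coeff m \<omega> h) (\<lambda>v. complex_of_real (h ^ length v) * ?stage v) v *s extended_basis (v @ w) x0))
          \<le> ?C' * \<bar>h\<bar> ^ (N - length w)"
      proof (rule word_expansion_compose[OF finite_I _ \<open>D \<ge> 0\<close> \<open>C1 \<ge> 0\<close> z(3) _ _ w])
        fix w :: "(int ^ 'd) list" assume w: "set w \<subseteq> I" "length w \<le> N"
        let ?p = "N - length w"
        have "norm (extended_basis w ?z' - (\<Sum>v\<in>words_below I ?p.
            (complex_of_real (h ^ length v) * ?stage v) *s extended_basis (v @ w) z)) \<le> C * (card I * \<bar>?\<beta> * h\<bar>) ^ ?p"
          by (rule stage_path_expansion[where Z = Z]) (use bound Z0 Z w in auto)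
        also have "\<dots> = C * (card I * \<bar>?\<beta>\<bar>) ^ ?p * \<bar>h\<bar> ^ ?p" by (simp add: abs_mult power_mult_distrib mult_ac)
        also have "\<dots> \<le> C2 * \<bar>h\<bar> ^ ?p"
        proof (rule mult_right_mono)
          have "(card I * \<bar>?\<beta>\<bar>) ^ ?p \<le> (1 + card I * \<bar>?\<beta>\<bar>) ^ ?p" by (intro power_mono) simp_all
          also have "\<dots> \<le> (1 + card I * \<bar>?\<beta>\<bar>) ^ N" by (intro power_increasing) simp_all
          finally show "C * (card I * \<bar>?\<beta>\<bar>) ^ ?p \<le> C2" unfolding C2_def using \<open>C \<ge> 0\<close> by (rule mult_left_mono)
        qed simp
        finally show "norm (extended_basis w ?z' - (\<Sum>v\<in>words_below I ?p.
            (complex_of_real (h ^ length v) * ?stage v) *s extended_basis (v @ w) z)) \<le> C2 * \<bar>h\<bar> ^ ?p" .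
      next
        fix v :: "(int ^ 'd) list" assume v: "v \<in> words_below I N"
        have "cmod (?stage v) \<le> \<bar>?\<beta>\<bar> ^ length v" by (rule norm_stage_coeff)
        also have "\<dots> \<le> (1 + \<bar>?\<beta>\<bar>) ^ length v" by (intro power_mono) simp_all
        also have "\<dots> \<le> D" unfolding D_def using v by (intro power_increasing) (simp_all add: words_below_def)
        finally have "\<bar>h\<bar> ^ length v * cmod (?stage v) \<le> \<bar>h\<bar> ^ length v * D" by (rule mult_left_mono) simp
        then show "cmod (complex_of_real (h ^ length v) * ?stage v) \<le> D * \<bar>h\<bar> ^ length v"
          by (simp add: norm_mult norm_power mult.commute)
      qed auto
      then show "norm (extended_basis w ?z' - (\<Sum>v\<in>words_below I (N - length w). ?coeff (Suc m) \<omega> h v *s extended_basis (v @ w) x0))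
          \<le> ?C' * \<bar>h\<bar> ^ (N - length w)"
        unfolding split_convolution_graded split_coeff_Suc .
    qed
  qed
qed

lemma split_coeff_Nil: "split_coeff r a b \<omega> [] h = 1"
proof -
  have "{js. length js = length ([] :: (int ^ 'd) list) \<and> sorted js \<and> set js \<subseteq> {1..r}} = {[]}" by auto
  then show ?thesis by (simp add: split_coeff_def)
qed

text \<open>
  Subtracting the two expansions cancels the empty word, whose coefficient is 1 in both.  What is left
  of \<open>cvec (z' - z)\<close> after removing the sum \<open>Q\<close> is a real vector because \<open>Q\<close> is invariant under
  conjugation.
\<close>

lemma local_error_expansion:
  fixes h K K' :: real
  assumes "x0 \<in> \<Omega>"
    and exact: "norm (cvec z - (\<Sum>v\<in>words_below I N. (complex_of_real (h ^ length v) * exact_coeff \<omega> v h) *s extended_basis v x0))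
      \<le> K * \<bar>h\<bar> ^ N"
    and split: "norm (cvec z' - (\<Sum>v\<in>words_below I N. (complex_of_real (h ^ length v) * split_coeff r a b \<omega> v h) *s extended_basis v x0))
      \<le> K' * \<bar>h\<bar> ^ N"
  shows "\<exists>\<rho>. cvec (z' - z) = (\<Sum>n=1..N-1. complex_of_real (h ^ n) *s
      (\<Sum>w\<in>{w. length w = n \<and> set w \<subseteq> I}. (split_coeff r a b \<omega> w h - exact_coeff \<omega> w h) *s word_basis ang fhat w x0))
      + cvec \<rho> \<and> norm \<rho> \<le> (K + K') * \<bar>h\<bar> ^ N"
proof -
  let ?W = "\<lambda>n. {w. length w = n \<and> set w \<subseteq> I}"
  let ?d = "\<lambda>w. split_coeff r a b \<omega> w h - exact_coeff \<omega> w h"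
  define Q where "Q = (\<Sum>n=1..N-1. complex_of_real (h ^ n) *s (\<Sum>w\<in>?W n. ?d w *s word_basis ang fhat w x0))"
  let ?S = "\<lambda>\<gamma>. \<Sum>v\<in>words_below I N. (complex_of_real (h ^ length v) * \<gamma> v) *s extended_basis v x0"
  have S: "?S \<gamma> = \<gamma> [] *s cvec x0 + (\<Sum>n=1..N-1. complex_of_real (h ^ n) *s (\<Sum>w\<in>?W n. \<gamma> w *s word_basis ang fhat w x0))" for \<gamma>
  proof -
    have "(\<Sum>w\<in>?W n. (complex_of_real (h ^ length w) * \<gamma> w) *s extended_basis w x0) =
        complex_of_real (h ^ n) *s (\<Sum>w\<in>?W n. \<gamma> w *s word_basis ang fhat w x0)" if "n \<in> {1..N-1}" for n
      unfolding smult_sum_right using that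
      by (intro sum.cong refl) (auto simp: extended_basis_def vector_smult_assoc)
    then show ?thesis
      using N_ge_2 by (simp add: sum_words_below_graded[OF finite_I] extended_basis_simps)
  qed
  have Q_eq: "?S (\<lambda>v. split_coeff r a b \<omega> v h) - ?S (\<lambda>v. exact_coeff \<omega> v h) = Q"
    unfolding S Q_def
    by (simp add: split_coeff_Nil exact_coeff_eq_iterated sum_subtractf vector_sub_rdistrib vector_ssub_ldistrib
        del: of_real_power)
  have "conj_vec Q = Q"
    unfolding Q_def conj_vec_sum
  proof (rule sum.cong[OF refl])
    fix n assume "n \<in> {1..N-1}"
    then have "conj_vec (\<Sum>w\<in>?W n. ?d w *s word_basis ang fhat w x0) = (\<Sum>w\<in>?W n. ?d w *s word_basis ang fhat w x0)"
      using \<open>x0 \<in> \<Omega>\<close> by (intro conj_vec_word_sum) (auto simp: exact_coeff_uminus split_coeff_uminus)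
    then show "conj_vec (complex_of_real (h ^ n) *s (\<Sum>w\<in>?W n. ?d w *s word_basis ang fhat w x0)) =
        complex_of_real (h ^ n) *s (\<Sum>w\<in>?W n. ?d w *s word_basis ang fhat w x0)"
      by (simp add: conj_vec_smult)
  qed
  then have Im_Q: "Im (Q $ i) = 0" for i
  proof -
    have "cnj (Q $ i) = Q $ i" using \<open>conj_vec Q = Q\<close> conj_vec_nth[of Q i] by simp
    then show ?thesis by (simp add: complex_eq_iff)
  qed
  define \<rho> where "\<rho> = (\<chi> i. Re ((cvec (z' - z) - Q) $ i))"
  have \<rho>: "cvec \<rho> = cvec (z' - z) - Q"
    by (simp add: \<rho>_def cvec_def vec_eq_iff complex_eq_iff Im_Q)
  have "cvec (z' - z) - Q = (cvec z' - ?S (\<lambda>v. split_coeff r a b \<omega> v h)) - (cvec z - ?S (\<lambda>v. exact_coeff \<omega> v h))"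
    unfolding Q_eq[symmetric] linear_diff[OF bounded_linear.linear[OF bounded_linear_cvec]] by simp
  then have "norm (cvec (z' - z) - Q) \<le> K' * \<bar>h\<bar> ^ N + K * \<bar>h\<bar> ^ N"
    using norm_triangle_le_diff[OF add_mono[OF split exact]] by simp
  then have "norm \<rho> \<le> (K + K') * \<bar>h\<bar> ^ N"
    unfolding \<rho>[symmetric] norm_cvec by (simp add: algebra_simps)
  with \<rho> show ?thesis unfolding Q_def[symmetric] by (intro exI[of _ \<rho>]) simp
qed

end

section \<open>The local error\<close>

theorem theorem4:
  fixes ang :: "'d::finite \<Rightarrow> 'n::finite"
    and a b :: "nat \<Rightarrow> real" and r N :: nat
    and f :: "real ^ 'n \<Rightarrow> real ^ 'n"
    and fhat :: "int ^ 'd \<Rightarrow> real ^ 'n \<Rightarrow> complex ^ 'n"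
    and y0 :: "real ^ 'n" and R :: real
    and I :: "(int ^ 'd) set"
  assumes "inj ang"
    and "y0 \<in> yspace ang" and "R > 0"
    and "\<And>x. x \<in> phase_domain ang y0 R \<Longrightarrow> ((\<lambda>k. mode ang fhat k x) has_sum cvec (f x)) UNIV"
    and "\<And>k y i. y \<in> yball ang y0 R \<Longrightarrow> fhat (- k) y $ i = cnj (fhat k y $ i)"
    and "finite I"
    and "\<And>k y. k \<notin> I \<Longrightarrow> y \<in> yball ang y0 R \<Longrightarrow> fhat k y = 0"
    and "N \<ge> 2"
    and "\<And>k. bounded_Ck (- range ang) (yball ang y0 R) (N - 1) (fhat k)"
  shows "\<exists>h0>0. \<exists>C>0. \<forall>\<omega> :: real ^ 'd. (\<forall>j. \<omega> $ j > 0) \<longrightarrow>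
    (\<forall>h \<theta>0. \<bar>h\<bar> < h0 \<longrightarrow>
      (let \<Omega> = phase_domain ang y0 R; x0 = state ang y0 \<theta>0; U = (\<lambda>_. state ang 0 \<omega>) in
       \<exists>x x'. flow (\<lambda>z. U z + f z) \<Omega> h x0 = Some x \<and> x \<in> \<Omega> \<and>
              splitting U f \<Omega> a b h r x0 = Some x' \<and> x' \<in> \<Omega> \<and>
              (\<exists>\<rho> :: real ^ 'n.
                 cvec (x' - x) =
                   cvec (state ang 0 ((h * ((\<Sum>j=1..r. a j) - 1)) *\<^sub>R \<omega>))
                   + (\<Sum>n=1..N-1. complex_of_real (h ^ n) *s
                        (\<Sum>w \<in> {w. length w = n \<and> set w \<subseteq> I}.
                           (split_coeff r a b \<omega> w h - exact_coeff \<omega> w h) *s word_basis ang fhat w x0))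
                   + cvec \<rho> \<and>
                 norm \<rho> \<le> C * \<bar>h\<bar> ^ N)))"
proof -
  interpret oscillatory_field ang f fhat y0 R I N
    by unfold_locales (fact assms)+
  obtain L M where LM: "L > 0" "M > 0"
    and Lip: "\<And>x y. x \<in> \<Omega> \<Longrightarrow> y \<in> \<Omega> \<Longrightarrow> norm (f x - f y) \<le> L * norm (x - y)"
    and M: "\<And>x. x \<in> \<Omega> \<Longrightarrow> norm (f x) \<le> M"
    using field_Lipschitz_bounded by blast
  obtain C where "C > 0"
    and C: "\<And>w x. set w \<subseteq> I \<Longrightarrow> length w = N \<Longrightarrow> x \<in> \<Omega> \<Longrightarrow> norm (extended_basis w x) \<le> C"
    using extended_basis_bounded by blast
  let ?s = "\<Sum>j=1..r. \<bar>b j\<bar>"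
  have "\<exists>C'\<ge>0. \<forall>\<omega> h x0. ypart ang x0 = y0 \<longrightarrow> \<bar>h\<bar> * ?s * M \<le> R / 2 \<longrightarrow> \<bar>h\<bar> * ?s * L < 1 \<longrightarrow>
      splitting_expands a b M C' r \<omega> h x0"
    by (rule splitting_expansion[where C = C]) (use C \<open>C > 0\<close> Lip M LM in auto)
  then obtain C' where "C' \<ge> 0"
    and C': "\<And>\<omega> h x0. ypart ang x0 = y0 \<Longrightarrow> \<bar>h\<bar> * ?s * M \<le> R / 2 \<Longrightarrow> \<bar>h\<bar> * ?s * L < 1 \<Longrightarrow>
      splitting_expands a b M C' r \<omega> h x0"
    by blast
  define S where "S = 1 + ?s"
  have "S \<ge> 1" "?s \<ge> 0" "?s \<le> S" by (simp_all add: S_def sum_nonneg)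
  \<comment> \<open>\<open>S * \<bar>h\<bar>\<close> bounds both the time of the exact step and the total time of the perturbation stages; the first bound keeps \<open>y\<close> in the ball of radius \<open>R / 2\<close>, the second one makes every Picard iteration a contraction.\<close>
  define h0 where "h0 = min (R / (2 * (S * M))) (1 / (S * L))"
  have "h0 > 0" using R_pos LM \<open>S \<ge> 1\<close> by (simp add: h0_def)
  \<comment> \<open>The summand 1 only makes the constant positive.\<close>
  define K where "K = C * card I ^ N + C' + 1"
  have "K > 0" using \<open>C > 0\<close> \<open>C' \<ge> 0\<close> by (simp add: K_def add_nonneg_pos)
  have main: "\<exists>x x'. flow (\<lambda>z. state ang 0 \<omega> + f z) \<Omega> h x0 = Some x \<and> x \<in> \<Omega> \<and>
      splitting (\<lambda>_. state ang 0 \<omega>) f \<Omega> a b h r x0 = Some x' \<and> x' \<in> \<Omega> \<and>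
      (\<exists>\<rho>. cvec (x' - x) = cvec (state ang 0 ((h * ((\<Sum>j=1..r. a j) - 1)) *\<^sub>R \<omega>))
         + (\<Sum>n=1..N-1. complex_of_real (h ^ n) *s
              (\<Sum>w \<in> {w. length w = n \<and> set w \<subseteq> I}.
                 (split_coeff r a b \<omega> w h - exact_coeff \<omega> w h) *s word_basis ang fhat w x0))
         + cvec \<rho> \<and> norm \<rho> \<le> K * \<bar>h\<bar> ^ N)"
    if "\<bar>h\<bar> < h0" and x0: "ypart ang x0 = y0" for \<omega> :: "real ^ 'd" and h x0
  proof -
    let ?u = "state ang 0 \<omega> :: real ^ 'n"
    have SM: "\<bar>h\<bar> * (S * M) < R / 2" and SL: "\<bar>h\<bar> * (S * L) < 1"
      using \<open>\<bar>h\<bar> < h0\<close> LM \<open>S \<ge> 1\<close> by (simp_all add: h0_def field_simps)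
    have shrink: "\<bar>h\<bar> * t * B \<le> \<bar>h\<bar> * (S * B)" if "t \<le> S" "B > 0" for t B
      using that by (simp add: mult.assoc mult_left_mono)
    have hM: "\<bar>h\<bar> * M \<le> R / 2" "\<bar>h\<bar> * ?s * M \<le> R / 2"
      using shrink[of 1 M] shrink[of ?s M] SM \<open>S \<ge> 1\<close> \<open>?s \<le> S\<close> LM by simp_all
    have hL: "\<bar>h\<bar> * L < 1" "\<bar>h\<bar> * ?s * L < 1"
      using shrink[of 1 L] shrink[of ?s L] SL \<open>S \<ge> 1\<close> \<open>?s \<le> S\<close> LM by simp_all
    have "x0 \<in> \<Omega>" using x0 R_pos by (simp add: phase_domain_iff)
    obtain z' where z': "splitting (\<lambda>_. ?u) f \<Omega> a b h r x0 = Some (z' + (h * (\<Sum>j=1..r. a j)) *\<^sub>R ?u)"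
        "norm (ypart ang z' - y0) \<le> \<bar>h\<bar> * ?s * M"
        "\<And>w. set w \<subseteq> I \<Longrightarrow> length w \<le> N \<Longrightarrow> norm (extended_basis w z' - (\<Sum>v\<in>words_below I (N - length w).
            (complex_of_real (h ^ length v) * split_coeff r a b \<omega> v h) *s extended_basis (v @ w) x0))
          \<le> C' * \<bar>h\<bar> ^ (N - length w)"
      using C'[OF x0 hM(2) hL(2), of \<omega>] unfolding splitting_expands_def by blast
    obtain Z where Z0: "Z 0 = x0"
      and Z: "\<And>s. s \<in> {0..1} \<Longrightarrow> Z s \<in> \<Omega> \<and> (Z has_vector_derivative h *\<^sub>R (?u + f (Z s))) (at s within {0..1})"
    proof (rule perturbed_path_exists[OF Lip _ M, of ?u h x0])
      show "ypart ang ?u = 0" by (rule ypart_state_0)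
      show "norm (ypart ang x0 - y0) + \<bar>h\<bar> * M \<le> R / 2" using hM(1) by (simp add: x0)
    qed (use hL LM in auto)
    have flow: "flow (\<lambda>z. ?u + f z) \<Omega> h x0 = Some (Z 1)"
      by (rule flow_eq_Some[where Z = Z and L = L]) (use hL LM Z Z0 Lip in auto)
    define z where "z = Z 1 - h *\<^sub>R ?u"
    let ?x' = "z' + (h * (\<Sum>j=1..r. a j)) *\<^sub>R ?u"
    have "?x' \<in> \<Omega>"
      using z'(2) hM(2) R_pos by (simp add: phase_domain_iff ypart_add ypart_scaleR ypart_state_0)
    have exact: "norm (cvec z - (\<Sum>v\<in>words_below I N. (complex_of_real (h ^ length v) * exact_coeff \<omega> v h) *s extended_basis v x0))
        \<le> (C * card I ^ N) * \<bar>h\<bar> ^ N"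
      using exact_path_expansion[where Z = Z and w = "[]", OF C Z0 Z]
      by (simp add: z_def extended_basis_simps power_mult_distrib mult.assoc)
    have split: "norm (cvec z' - (\<Sum>v\<in>words_below I N. (complex_of_real (h ^ length v) * split_coeff r a b \<omega> v h) *s extended_basis v x0))
        \<le> C' * \<bar>h\<bar> ^ N"
      using z'(3)[of "[]"] by (simp add: extended_basis_simps)
    obtain \<rho> where \<rho>: "cvec (z' - z) = (\<Sum>n=1..N-1. complex_of_real (h ^ n) *s
          (\<Sum>w\<in>{w. length w = n \<and> set w \<subseteq> I}. (split_coeff r a b \<omega> w h - exact_coeff \<omega> w h) *s word_basis ang fhat w x0))
          + cvec \<rho>" "norm \<rho> \<le> (C * card I ^ N + C') * \<bar>h\<bar> ^ N"
      using local_error_expansion[OF \<open>x0 \<in> \<Omega>\<close> exact split] by blast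
    have "?x' - Z 1 = state ang 0 ((h * ((\<Sum>j=1..r. a j) - 1)) *\<^sub>R \<omega>) + (z' - z)"
      unfolding z_def state_0_scaleR by (simp add: algebra_simps)
    then have "cvec (?x' - Z 1) = cvec (state ang 0 ((h * ((\<Sum>j=1..r. a j) - 1)) *\<^sub>R \<omega>)) + cvec (z' - z)"
      by (simp only: linear_add[OF bounded_linear.linear[OF bounded_linear_cvec]])
    moreover have "norm \<rho> \<le> K * \<bar>h\<bar> ^ N"
      using \<rho>(2) mult_right_mono[of "C * card I ^ N + C'" K "\<bar>h\<bar> ^ N"] by (simp add: K_def)
    ultimately show ?thesis
      using flow Z[of 1] z'(1) \<open>?x' \<in> \<Omega>\<close> \<rho>(1)
      by (intro exI[of _ "Z 1"] exI[of _ ?x'] conjI exI[of _ \<rho>]) (auto simp: add.assoc)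
  qed
  have ypart_x0: "ypart ang (state ang y0 \<theta>0) = y0" for \<theta>0
    using y0 by (auto simp: ypart_def state_def yspace_def vec_eq_iff)
  show ?thesis
    unfolding Let_def
  proof (rule exI[of _ h0], rule conjI[OF \<open>h0 > 0\<close>], rule exI[of _ K], rule conjI[OF \<open>K > 0\<close>],
      intro allI impI)
    fix \<omega> :: "real ^ 'd" and h :: real and \<theta>0 :: "real ^ 'd"
    assume "\<bar>h\<bar> < h0"
    from main[OF this ypart_x0] show "\<exists>x x'. flow (\<lambda>z. state ang 0 \<omega> + f z) \<Omega> h (state ang y0 \<theta>0) = Some x \<and> x \<in> \<Omega> \<and>
      splitting (\<lambda>_. state ang 0 \<omega>) f \<Omega> a b h r (state ang y0 \<theta>0) = Some x' \<and> x' \<in> \<Omega> \<and>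
      (\<exists>\<rho>. cvec (x' - x) = cvec (state ang 0 ((h * ((\<Sum>j=1..r. a j) - 1)) *\<^sub>R \<omega>))
         + (\<Sum>n=1..N-1. complex_of_real (h ^ n) *s
              (\<Sum>w \<in> {w. length w = n \<and> set w \<subseteq> I}.
                 (split_coeff r a b \<omega> w h - exact_coeff \<omega> w h) *s word_basis ang fhat w (state ang y0 \<theta>0)))
         + cvec \<rho> \<and> norm \<rho> \<le> K * \<bar>h\<bar> ^ N)" .
  qed
qed

end
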